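(* Let $P$ be a process of the calculus $\mathsf{s}\pi^{+}$ such that $P\vdash\emptyset$ and $P\not\equiv\mathbf 0$. Then there exist a process $Q$ and a non-empty set of names $S$ such that $P\leadsto_S Q$.
   Context: The calculus $\mathsf{s}\pi^{+}$ (a session-typed $\pi$-calculus with non-deterministic choice). Names are $x,y,z,w,\dots$; $\widetilde{x}$ is a finite tuple of names. Processes: $P,Q ::= \mathbf{0}$ (inaction) $\mid [x\leftrightarrow y]$ (forwarder) $\mid (\nu x)(P \mid Q)$ (connect) $\mid P \boxplus Q$ (non-deterministic choice) $\mid \overline{x}[y];(P\mid Q)$ (output of a fresh name $y$) $\mid x(y);P$ (input) $\mid \overline{x}\triangleleft \ell;P$ (select label $\ell$) $\mid x\triangleright\{i:P_i\}_{i\in I}$ (branch, $I$ finite) $\mid \overline{x}[\,]$ (close) $\mid x();P$ (wait) $\mid x.\mathtt{some}_{(w_1,\dots,w_n)};P$ (expect) $\mid \overline{x}.\mathtt{some};P$ (available) $\mid \overline{x}.\mathtt{none}$ (unavailable) $\mid P\mid Q$ (parallel). Name $y$ is bound in $(\nu y)(P\mid Q)$, $\overline{x}[y];(P\mid Q)$, $x(y);P$; $\mathrm{fn}(P)$ is the set of free names. $\boxplus$ is associative; $\boxplus_{i\in I}P_i$ is the choice among all $P_i$. $P\{y/z\}$ is capture-avoiding substitution. In the subscript of expect, names and sets of names are freely combined (union). Structural congruence $\equiv$ is the least congruence with: $P\equiv P'$ if $\alpha$-equivalent; $[x\leftrightarrow y]\equiv[y\leftrightarrow x]$; $P\mid \mathbf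 0\equiv P$; $(P\mid Q)\mid R\equiv P\mid(Q\mid R)$; $P\mid Q\equiv Q\mid P$; $(\nu x)(P\mid Q)\equiv(\nu x)(Q\mid P)$; $P\boxplus P\equiv P$; $P\boxplus Q\equiv Q\boxplus P$; $(P\boxplus Q)\boxplus R\equiv P\boxplus(Q\boxplus R)$; $(\nu x)((P\mid Q)\mid R)\equiv(\nu x)(P\mid R)\mid Q$ if $x\notin\mathrm{fn}(Q)$; $(\nu x)((\nu y)(P\mid Q)\mid R)\equiv(\nu y)((\nu x)(P\mid R)\mid Q)$ if $x\notin\mathrm{fn}(Q)$, $y\notin\mathrm{fn}(R)$. ND-contexts: $N ::= [\cdot]\mid N\mid P\mid (\nu x)(N\mid P)\mid N\boxplus P$; D-contexts $C,D$ are ND-contexts not using the clause $N\boxplus P$. $N[P]$ is hole-filling. Prefixes: $\alpha,\beta ::= \overline{x}[y]\mid x(y)\mid \overline{x}\triangleleft\ell\mid x\triangleright\mid \overline{x}[\,]\mid x()\mid \overline{x}.\mathtt{some}\mid\overline{x}.\mathtt{none}\mid x.\mathtt{some}_{\widetilde{w}}\mid[x\leftrightarrow y]$, with subjects $\mathrm{sub}([x\leftrightarrow y])=\{x,y\}$ and $\mathrm{sub}(\alpha)=\{x\}$ otherwise; $\alpha;P$ denotes a prefixed process. Let $\bowtie$ be the least relation with $\overline{x}[y]\bowtie\overline{x}[z]$, $x(y)\bowtie x(z)$, and $\alpha\bowtie\alpha$. Precongruence $P \succeq_S Q$ (for non-empty $S\subseteq\{x,y\}$) holds when: (1) if $S=\{x\}$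 then $P=(\boxplus_{i\in I}C_i[\alpha_i;P_i])\boxplus(\boxplus_{j\in J}C_j[\beta_j;Q_j])$ and $Q=\boxplus_{i\in I}C_i[\alpha_i;P_i]$ with all $\alpha_i\bowtie\alpha_{i'}$, $\mathrm{sub}(\alpha_i)=\{x\}$, and for all $i,j$: $\alpha_i\not\bowtie\beta_j$ and $x\in\mathrm{fn}(\beta_j;Q_j)$; (2) if $S=\{x,y\}$ then $P=(\boxplus_{i\in I}C_i[[x\leftrightarrow y]])\boxplus(\boxplus_{j\in J}C_j[[x\leftrightarrow z_j]])\boxplus(\boxplus_{k\in K}C_k[\alpha_k;P_k])$ and $Q=\boxplus_{i\in I}C_i[[x\leftrightarrow y]]$ with $z_j\neq y$, $x\in\mathrm{fn}(\alpha_k;P_k)$ and $\alpha_k\not\bowtie[x\leftrightarrow z]$ for all $z$. (Here $C_i,C_j,C_k,D_j$ are D-contexts.) Reduction $\leadsto_S$ (writing $\leadsto_{x}$ for $\leadsto_{\{x\}}$): (Id) $(\nu x)(\boxplus_{i\in I}C_i[[x\leftrightarrow y]]\mid Q)\leadsto_{x,y}\boxplus_{i\in I}C_i[Q\{y/x\}]$. (Comm) $(\nu x)(\boxplus_{i}C_i[\overline{x}[y_i];(P_i\mid Q_i)]\mid\boxplus_{j}D_j[x(z);R_j])\leadsto_x\boxplus_i C_i[(\nu x)(Q_i\mid(\nu w)(P_i\{w/y_i\}\mid\boxplus_j D_j[R_j\{w/z\}]))]$. (Sel) $(\nu x)(\boxplus_iC_i[\overline{x}\triangleleft k';P_i]\mid\boxplus_jD_j[x\triangleright\{k:Q^k_j\}_{k\in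 K}])\leadsto_x(\nu x)(\boxplus_iC_i[P_i]\mid\boxplus_jD_j[Q^{k'}_j])$ if $k'\in K$. (Close) $(\nu x)(\boxplus_iC_i[\overline{x}[\,]]\mid\boxplus_jD_j[x();Q_j])\leadsto_x\boxplus_iC_i[\mathbf 0]\mid\boxplus_jD_j[Q_j]$. (Some) $(\nu x)(\boxplus_iC_i[\overline{x}.\mathtt{some};P_i]\mid\boxplus_jD_j[x.\mathtt{some}_{(w_1,\dots,w_n)};Q_j])\leadsto_x(\nu x)(\boxplus_iC_i[P_i]\mid\boxplus_jD_j[Q_j])$. (None) $(\nu x)(\boxplus_iC_i[\overline{x}.\mathtt{none}]\mid\boxplus_jD_j[x.\mathtt{some}_{(w_1,\dots,w_n)};Q_j])\leadsto_x\boxplus_iC_i[\mathbf 0]\mid\boxplus_jD_j[\overline{w_1}.\mathtt{none}\mid\dots\mid\overline{w_n}.\mathtt{none}]$. ($\succeq$) if $x\in S$, $P\succeq_S P'$, $Q\succeq_S Q'$ and $(\nu x)(P'\mid Q')\leadsto_S R$ then $(\nu x)(P\mid Q)\leadsto_S R$. ($\nu\boxplus$) if $(\nu x)(P\mid N[C[Q_1]\boxplus C[Q_2]])\leadsto_S R$ then $(\nu x)(P\mid N[C[Q_1\boxplus Q_2]])\leadsto_S R$. Closure: if $P\equiv P'\leadsto_S Q'\equiv Q$ then $P\leadsto_S Q$; if $P\leadsto_S P'$ then $(\nu x)(P\mid Q)\leadsto_S(\nu x)(P'\mid Q)$, $P\mid Q\leadsto_S P'\mid Q$, and $P\boxplus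 Q\leadsto_S P'\boxplus Q$. Session types: $A,B::=\mathbf 1\mid\bot\mid A\otimes B\mid A\wp B\mid\oplus\{i:A_i\}_{i\in I}\mid\&\{i:A_i\}_{i\in I}\mid\& A\mid\oplus A$ ($\wp$ is the multiplicative disjunction "par"). Duality $\overline{\cdot}$: $\overline{\mathbf 1}=\bot$, $\overline{\bot}=\mathbf 1$, $\overline{A\otimes B}=\overline A\wp\overline B$, $\overline{A\wp B}=\overline A\otimes\overline B$, $\overline{\oplus\{i:A_i\}}=\&\{i:\overline{A_i}\}$, $\overline{\&\{i:A_i\}}=\oplus\{i:\overline{A_i}\}$, $\overline{\&A}=\oplus\overline A$, $\overline{\oplus A}=\&\overline A$. Contexts $\Gamma$ are finite sets of assignments $x:A$ with distinct names; $\&\Gamma$ means every type in $\Gamma$ has the form $\&A'$. Typing rules for $P\vdash\Gamma$: (cut) from $P\vdash\Gamma,x:A$ and $Q\vdash\Delta,x:\overline A$ infer $(\nu x)(P\mid Q)\vdash\Gamma,\Delta$; (mix) from $P\vdash\Gamma$, $Q\vdash\Delta$ infer $P\mid Q\vdash\Gamma,\Delta$; ($\boxplus$) from $P\vdash\Gamma$, $Q\vdash\Gamma$ infer $P\boxplus Q\vdash\Gamma$; $\mathbf 0\vdash\emptyset$; $[x\leftrightarrow y]\vdash x:A,y:\overline A$; $\overline{x}[\,]\vdash x:\mathbf 1$; from $P\vdash\Gamma$ infer $x();P\vdash\Gamma,x:\bot$; from $P\vdash\Gamma,y:A$ and $Q\vdash\Delta,x:B$ infer $\overline{x}[y];(P\mid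 Q)\vdash\Gamma,\Delta,x:A\otimes B$; from $P\vdash\Gamma,y:A,x:B$ infer $x(y);P\vdash\Gamma,x:A\wp B$; from $P\vdash\Gamma,x:A_j$, $j\in I$ infer $\overline{x}\triangleleft j;P\vdash\Gamma,x:\oplus\{i:A_i\}_{i\in I}$; from $P_i\vdash\Gamma,x:A_i$ for all $i\in I$ infer $x\triangleright\{i:P_i\}_{i\in I}\vdash\Gamma,x:\&\{i:A_i\}_{i\in I}$; from $P\vdash\Gamma,x:A$ infer $\overline{x}.\mathtt{some};P\vdash\Gamma,x:\&A$; $\overline{x}.\mathtt{none}\vdash x:\&A$; from $P\vdash\&\Gamma,x:A$ infer $x.\mathtt{some}_{\mathrm{dom}(\Gamma)};P\vdash\&\Gamma,x:\oplus A$. *)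

theory Defs
  imports "HOL-Library.Finite_Map"
begin

section \<open>Processes\<close>

type_synonym name = nat
type_synonym label = nat

text \<open>Processes are raw terms with named binders; alpha-conversion is part of structural
  congruence. Finite label-indexed families are finite maps, and the subscript of an expect
  prefix is a finite set of names.\<close>

datatype proc =
    Inact
  | Fwd name name
  | Res name proc proc             (* connect *)
  | Choice proc proc               (infixr "\<boxplus>" 60)
  | Out name name proc proc
  | Inp name name proc
  | Sel name label proc
  | Branch name "(label, proc) fmap"
  | Close name
  | Wait name proc
  | Expect name "name fset" proc
  | Avail name proc
  | Unavail name
  | Par proc proc                  (infixr "\<parallel>" 65)

text \<open>In \<open>Out x y P Q\<close> the name \<open>y\<close> is bound in \<open>P\<close> only: the typing rule
  assigns \<open>y\<close> in the context of \<open>P\<close>, and rule \<open>Comm\<close> substitutes for \<open>y\<close> in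
  \<open>P\<close> only.\<close>

primrec fn :: "proc \<Rightarrow> name set" where
  "fn Inact = {}"
| "fn (Fwd x y) = {x, y}"
| "fn (Res x P Q) = (fn P \<union> fn Q) - {x}"
| "fn (P \<boxplus> Q) = fn P \<union> fn Q"
| "fn (Out x y P Q) = {x} \<union> (fn P - {y}) \<union> fn Q"
| "fn (Inp x y P) = {x} \<union> (fn P - {y})"
| "fn (Sel x l P) = {x} \<union> fn P"
| "fn (Branch x B) = {x} \<union> \<Union> (fmran' (fmmap fn B))"
| "fn (Close x) = {x}"
| "fn (Wait x P) = {x} \<union> fn P"
| "fn (Expect x W P) = {x} \<union> fset W \<union> fn P"
| "fn (Avail x P) = {x} \<union> fn P"
| "fn (Unavail x) = {x}"
| "fn (P \<parallel> Q) = fn P \<union> fn Q"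

definition avoid :: "name \<Rightarrow> name set \<Rightarrow> name" where
  "avoid y X = (if y \<in> X then LEAST z. z \<notin> X else y)"

text \<open>Simultaneous capture-avoiding substitution: a bound name is kept unless it would
  capture a substituted name.\<close>

primrec subst :: "proc \<Rightarrow> (name \<Rightarrow> name) \<Rightarrow> proc" where
  "subst Inact \<sigma> = Inact"
| "subst (Fwd x y) \<sigma> = Fwd (\<sigma> x) (\<sigma> y)"
| "subst (Res x P Q) \<sigma> =
     (let x' = avoid x (\<sigma> ` ((fn P \<union> fn Q) - {x}))
      in Res x' (subst P (\<sigma>(x := x'))) (subst Q (\<sigma>(x := x'))))"
| "subst (P \<boxplus> Q) \<sigma> = subst P \<sigma> \<boxplus> subst Q \<sigma>"
| "subst (Out x y P Q) \<sigma> =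
     (let y' = avoid y (\<sigma> ` (fn P - {y}))
      in Out (\<sigma> x) y' (subst P (\<sigma>(y := y'))) (subst Q \<sigma>))"
| "subst (Inp x y P) \<sigma> =
     (let y' = avoid y (\<sigma> ` (fn P - {y}))
      in Inp (\<sigma> x) y' (subst P (\<sigma>(y := y'))))"
| "subst (Sel x l P) \<sigma> = Sel (\<sigma> x) l (subst P \<sigma>)"
| "subst (Branch x B) \<sigma> = Branch (\<sigma> x) (fmmap (\<lambda>f. f \<sigma>) (fmmap subst B))"
| "subst (Close x) \<sigma> = Close (\<sigma> x)"
| "subst (Wait x P) \<sigma> = Wait (\<sigma> x) (subst P \<sigma>)"
| "subst (Expect x W P) \<sigma> = Expect (\<sigma> x) (\<sigma> |`| W) (subst P \<sigma>)"
| "subst (Avail x P) \<sigma> = Avail (\<sigma> x) (subst P \<sigma>)"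
| "subst (Unavail x) \<sigma> = Unavail (\<sigma> x)"
| "subst (P \<parallel> Q) \<sigma> = subst P \<sigma> \<parallel> subst Q \<sigma>"

abbreviation rename :: "proc \<Rightarrow> name \<Rightarrow> name \<Rightarrow> proc"  ("_\<lbrace>_'/_\<rbrace>" [1000, 0, 0] 1000) where
  "P\<lbrace>y/z\<rbrace> \<equiv> subst P (id(z := y))"

text \<open>The choice among a finite non-empty family; the equation for the empty list is a dummy
  and is never used.\<close>

fun choices :: "proc list \<Rightarrow> proc" where
  "choices [] = Inact"
| "choices [P] = P"
| "choices (P # Q # Ps) = P \<boxplus> choices (Q # Ps)"

text \<open>The parallel composition of the unavailable prefixes on the names in \<open>W\<close>.\<close>

definition unavails :: "name fset \<Rightarrow> proc" where
  "unavails W = foldr (\<lambda>w P. Unavail w \<parallel> P) (sorted_list_of_fset W) Inact"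


section \<open>Structural congruence\<close>

inductive alpha_step :: "proc \<Rightarrow> proc \<Rightarrow> bool" where
  "y \<notin> fn P \<union> fn Q \<Longrightarrow> alpha_step (Res x P Q) (Res y (P\<lbrace>y/x\<rbrace>) (Q\<lbrace>y/x\<rbrace>))"
| "z \<notin> fn P \<Longrightarrow> alpha_step (Out x y P Q) (Out x z (P\<lbrace>z/y\<rbrace>) Q)"
| "z \<notin> fn P \<Longrightarrow> alpha_step (Inp x y P) (Inp x z (P\<lbrace>z/y\<rbrace>))"

text \<open>As a congruence containing \<open>alpha_step\<close>, structural congruence contains
  alpha-equivalence.\<close>

inductive scong :: "proc \<Rightarrow> proc \<Rightarrow> bool"  (infix "\<equiv>\<^sub>s" 50) where
  alpha: "alpha_step P Q \<Longrightarrow> P \<equiv>\<^sub>s Q"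
| fwd_sym: "Fwd x y \<equiv>\<^sub>s Fwd y x"
| par_inact: "P \<parallel> Inact \<equiv>\<^sub>s P"
| par_assoc: "(P \<parallel> Q) \<parallel> R \<equiv>\<^sub>s P \<parallel> (Q \<parallel> R)"
| par_comm: "P \<parallel> Q \<equiv>\<^sub>s Q \<parallel> P"
| res_comm: "Res x P Q \<equiv>\<^sub>s Res x Q P"
| choice_idem: "P \<boxplus> P \<equiv>\<^sub>s P"
| choice_comm: "P \<boxplus> Q \<equiv>\<^sub>s Q \<boxplus> P"
| choice_assoc: "(P \<boxplus> Q) \<boxplus> R \<equiv>\<^sub>s P \<boxplus> (Q \<boxplus> R)"
| res_par: "x \<notin> fn Q \<Longrightarrow> Res x (P \<parallel> Q) R \<equiv>\<^sub>s Res x P R \<parallel> Q"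
| res_res: "x \<notin> fn Q \<Longrightarrow> y \<notin> fn R \<Longrightarrow> Res x (Res y P Q) R \<equiv>\<^sub>s Res y (Res x P R) Q"
| refl: "P \<equiv>\<^sub>s P"
| sym: "P \<equiv>\<^sub>s Q \<Longrightarrow> Q \<equiv>\<^sub>s P"
| trans: "P \<equiv>\<^sub>s Q \<Longrightarrow> Q \<equiv>\<^sub>s R \<Longrightarrow> P \<equiv>\<^sub>s R"
| cong_res: "P \<equiv>\<^sub>s P' \<Longrightarrow> Q \<equiv>\<^sub>s Q' \<Longrightarrow> Res x P Q \<equiv>\<^sub>s Res x P' Q'"
| cong_choice: "P \<equiv>\<^sub>s P' \<Longrightarrow> Q \<equiv>\<^sub>s Q' \<Longrightarrow> P \<boxplus> Q \<equiv>\<^sub>s P' \<boxplus> Q'"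
| cong_out: "P \<equiv>\<^sub>s P' \<Longrightarrow> Q \<equiv>\<^sub>s Q' \<Longrightarrow> Out x y P Q \<equiv>\<^sub>s Out x y P' Q'"
| cong_inp: "P \<equiv>\<^sub>s P' \<Longrightarrow> Inp x y P \<equiv>\<^sub>s Inp x y P'"
| cong_sel: "P \<equiv>\<^sub>s P' \<Longrightarrow> Sel x l P \<equiv>\<^sub>s Sel x l P'"
| cong_branch: "fmrel scong B B' \<Longrightarrow> Branch x B \<equiv>\<^sub>s Branch x B'"
| cong_wait: "P \<equiv>\<^sub>s P' \<Longrightarrow> Wait x P \<equiv>\<^sub>s Wait x P'"
| cong_expect: "P \<equiv>\<^sub>s P' \<Longrightarrow> Expect x W P \<equiv>\<^sub>s Expect x W P'"
| cong_avail: "P \<equiv>\<^sub>s P' \<Longrightarrow> Avail x P \<equiv>\<^sub>s Avail x P'"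
| cong_par: "P \<equiv>\<^sub>s P' \<Longrightarrow> Q \<equiv>\<^sub>s Q' \<Longrightarrow> P \<parallel> Q \<equiv>\<^sub>s P' \<parallel> Q'"
monos fmap.rel_mono_strong


section \<open>Contexts and prefixes\<close>

datatype ctx =
    Hole
  | CPar ctx proc
  | CRes name ctx proc
  | CChoice ctx proc

text \<open>Hole-filling may capture free names of the filler.\<close>

primrec fill :: "ctx \<Rightarrow> proc \<Rightarrow> proc"  ("_\<langle>_\<rangle>" [1000, 0] 1000) where
  "Hole\<langle>P\<rangle> = P"
| "(CPar N Q)\<langle>P\<rangle> = N\<langle>P\<rangle> \<parallel> Q"
| "(CRes x N Q)\<langle>P\<rangle> = Res x (N\<langle>P\<rangle>) Q"
| "(CChoice N Q)\<langle>P\<rangle> = N\<langle>P\<rangle> \<boxplus> Q"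

primrec dctx :: "ctx \<Rightarrow> bool" where
  "dctx Hole = True"
| "dctx (CPar N Q) = dctx N"
| "dctx (CRes x N Q) = dctx N"
| "dctx (CChoice N Q) = False"

text \<open>The names that a context binds at its hole.\<close>

primrec bn :: "ctx \<Rightarrow> name set" where
  "bn Hole = {}"
| "bn (CPar N Q) = bn N"
| "bn (CRes x N Q) = insert x (bn N)"
| "bn (CChoice N Q) = bn N"

datatype prefix =
    POut name name
  | PInp name name
  | PSel name label
  | PBranch name
  | PClose name
  | PWait name
  | PAvail name
  | PUnavail name
  | PExpect name "name fset"
  | PFwd name name

fun sub :: "prefix \<Rightarrow> name set" where
  "sub (POut x y) = {x}"
| "sub (PInp x y) = {x}"
| "sub (PSel x l) = {x}"
| "sub (PBranch x) = {x}"
| "sub (PClose x) = {x}"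
| "sub (PWait x) = {x}"
| "sub (PAvail x) = {x}"
| "sub (PUnavail x) = {x}"
| "sub (PExpect x W) = {x}"
| "sub (PFwd x y) = {x, y}"

text \<open>\<open>prefixed \<alpha> R\<close> says that \<open>R\<close> is a prefixed process of the form \<open>\<alpha>;P\<close>.\<close>

inductive prefixed :: "prefix \<Rightarrow> proc \<Rightarrow> bool" where
  "prefixed (POut x y) (Out x y P Q)"
| "prefixed (PInp x y) (Inp x y P)"
| "prefixed (PSel x l) (Sel x l P)"
| "prefixed (PBranch x) (Branch x B)"
| "prefixed (PClose x) (Close x)"
| "prefixed (PWait x) (Wait x P)"
| "prefixed (PAvail x) (Avail x P)"
| "prefixed (PUnavail x) (Unavail x)"
| "prefixed (PExpect x W) (Expect x W P)"
| "prefixed (PFwd x y) (Fwd x y)"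

inductive bowtie :: "prefix \<Rightarrow> prefix \<Rightarrow> bool"  (infix "\<bowtie>" 50) where
  "POut x y \<bowtie> POut x z"
| "PInp x y \<bowtie> PInp x z"
| "\<alpha> \<bowtie> \<alpha>"


section \<open>Precongruence and reduction\<close>

text \<open>The conditions on \<open>bn\<close> below, absent from the usual presentation, make the convention
  that bound names differ from all other names explicit for raw terms: the subject \<open>x\<close> at the
  hole is the free \<open>x\<close>, and no process is moved under a binder of one of its free names.\<close>

text \<open>An entry \<open>(C, \<alpha>, R)\<close> stands for \<open>C[\<alpha>;P]\<close>, where \<open>R = \<alpha>;P\<close>; the lists \<open>bs\<close>,
  \<open>js\<close> and \<open>ks\<close> may be empty.\<close>

inductive precong :: "name set \<Rightarrow> proc \<Rightarrow> proc \<Rightarrow> bool" where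
  precong_single:
  "\<lbrakk> as \<noteq> [];
     \<forall>(C, \<alpha>, R) \<in> set as. dctx C \<and> x \<notin> bn C \<and> prefixed \<alpha> R \<and> sub \<alpha> = {x};
     \<forall>(C, \<alpha>, R) \<in> set as. \<forall>(C', \<alpha>', R') \<in> set as. \<alpha> \<bowtie> \<alpha>';
     \<forall>(D, \<beta>, R) \<in> set bs. dctx D \<and> x \<notin> bn D \<and> prefixed \<beta> R \<and> x \<in> fn R;
     \<forall>(C, \<alpha>, R) \<in> set as. \<forall>(D, \<beta>, R') \<in> set bs. \<not> \<alpha> \<bowtie> \<beta> \<rbrakk>
   \<Longrightarrow> precong {x}
         (choices (map (\<lambda>(C, \<alpha>, R). C\<langle>R\<rangle>) as @ map (\<lambda>(D, \<beta>, R). D\<langle>R\<rangle>) bs))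
         (choices (map (\<lambda>(C, \<alpha>, R). C\<langle>R\<rangle>) as))"
| precong_fwd:
  "\<lbrakk> x \<noteq> y; is \<noteq> [];
     \<forall>C \<in> set is. dctx C \<and> x \<notin> bn C;
     \<forall>(C, z) \<in> set js. dctx C \<and> x \<notin> bn C \<and> z \<noteq> y;
     \<forall>(C, \<alpha>, R) \<in> set ks. dctx C \<and> x \<notin> bn C \<and> prefixed \<alpha> R \<and> x \<in> fn R \<and>
       (\<forall>z. \<not> \<alpha> \<bowtie> PFwd x z) \<rbrakk>
   \<Longrightarrow> precong {x, y}
         (choices (map (\<lambda>C. C\<langle>Fwd x y\<rangle>) is @ map (\<lambda>(C, z). C\<langle>Fwd x z\<rangle>) js
                   @ map (\<lambda>(C, \<alpha>, R). C\<langle>R\<rangle>) ks))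
         (choices (map (\<lambda>C. C\<langle>Fwd x y\<rangle>) is))"

text \<open>The lists \<open>cs\<close> and \<open>ds\<close> are the families indexed by \<open>i\<close> and \<open>j\<close>.\<close>

inductive red :: "proc \<Rightarrow> name set \<Rightarrow> proc \<Rightarrow> bool"  ("_ \<leadsto>[_] _" [51, 0, 51] 50) where
  Id:
  "\<lbrakk> cs \<noteq> []; x \<noteq> y;
     \<forall>C \<in> set cs. dctx C \<and> x \<notin> bn C \<and> bn C \<inter> fn Q = {} \<rbrakk>
   \<Longrightarrow> Res x (choices (map (\<lambda>C. C\<langle>Fwd x y\<rangle>) cs)) Q \<leadsto>[{x, y}]
       choices (map (\<lambda>C. C\<langle>Q\<lbrace>y/x\<rbrace>\<rangle>) cs)"
| Comm:
  "\<lbrakk> cs \<noteq> []; ds \<noteq> [];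
     T = choices (map (\<lambda>(D, R). D\<langle>Inp x z R\<rangle>) ds);
     \<forall>(C, y, P, Q) \<in> set cs. dctx C \<and> x \<notin> bn C \<and> bn C \<inter> fn T = {} \<and> w \<notin> fn (Out x y P Q);
     \<forall>(D, R) \<in> set ds. dctx D \<and> x \<notin> bn D \<and> w \<notin> bn D;
     w \<notin> fn T \<rbrakk>
   \<Longrightarrow> Res x (choices (map (\<lambda>(C, y, P, Q). C\<langle>Out x y P Q\<rangle>) cs)) T \<leadsto>[{x}]
       choices (map (\<lambda>(C, y, P, Q).
         C\<langle>Res x Q (Res w (P\<lbrace>w/y\<rbrace>) (choices (map (\<lambda>(D, R). D\<langle>R\<lbrace>w/z\<rbrace>\<rangle>) ds)))\<rangle>) cs)"
| Sel:
  "\<lbrakk> cs \<noteq> []; ds \<noteq> []; k' |\<in>| K;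
     \<forall>(C, P) \<in> set cs. dctx C \<and> x \<notin> bn C;
     \<forall>(D, B) \<in> set ds. dctx D \<and> x \<notin> bn D \<and> fmdom B = K \<rbrakk>
   \<Longrightarrow> Res x (choices (map (\<lambda>(C, P). C\<langle>Sel x k' P\<rangle>) cs))
             (choices (map (\<lambda>(D, B). D\<langle>Branch x B\<rangle>) ds)) \<leadsto>[{x}]
       Res x (choices (map (\<lambda>(C, P). C\<langle>P\<rangle>) cs))
             (choices (map (\<lambda>(D, B). D\<langle>the (fmlookup B k')\<rangle>) ds))"
| Close:
  "\<lbrakk> cs \<noteq> []; ds \<noteq> [];
     \<forall>C \<in> set cs. dctx C \<and> x \<notin> bn C;
     \<forall>(D, Q) \<in> set ds. dctx D \<and> x \<notin> bn D \<rbrakk>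
   \<Longrightarrow> Res x (choices (map (\<lambda>C. C\<langle>Close x\<rangle>) cs))
             (choices (map (\<lambda>(D, Q). D\<langle>Wait x Q\<rangle>) ds)) \<leadsto>[{x}]
       choices (map (\<lambda>C. C\<langle>Inact\<rangle>) cs) \<parallel> choices (map (\<lambda>(D, Q). D\<langle>Q\<rangle>) ds)"
| Some:
  "\<lbrakk> cs \<noteq> []; ds \<noteq> [];
     \<forall>(C, P) \<in> set cs. dctx C \<and> x \<notin> bn C;
     \<forall>(D, Q) \<in> set ds. dctx D \<and> x \<notin> bn D \<rbrakk>
   \<Longrightarrow> Res x (choices (map (\<lambda>(C, P). C\<langle>Avail x P\<rangle>) cs))
             (choices (map (\<lambda>(D, Q). D\<langle>Expect x W Q\<rangle>) ds)) \<leadsto>[{x}]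
       Res x (choices (map (\<lambda>(C, P). C\<langle>P\<rangle>) cs)) (choices (map (\<lambda>(D, Q). D\<langle>Q\<rangle>) ds))"
| None:
  "\<lbrakk> cs \<noteq> []; ds \<noteq> [];
     \<forall>C \<in> set cs. dctx C \<and> x \<notin> bn C;
     \<forall>(D, Q) \<in> set ds. dctx D \<and> x \<notin> bn D \<rbrakk>
   \<Longrightarrow> Res x (choices (map (\<lambda>C. C\<langle>Unavail x\<rangle>) cs))
             (choices (map (\<lambda>(D, Q). D\<langle>Expect x W Q\<rangle>) ds)) \<leadsto>[{x}]
       choices (map (\<lambda>C. C\<langle>Inact\<rangle>) cs) \<parallel> choices (map (\<lambda>(D, Q). D\<langle>unavails W\<rangle>) ds)"
| Pre:
  "\<lbrakk> x \<in> S; precong S P P'; precong S Q Q'; Res x P' Q' \<leadsto>[S] R \<rbrakk>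
   \<Longrightarrow> Res x P Q \<leadsto>[S] R"
| Res_Choice:
  "\<lbrakk> dctx C; Res x P (N\<langle>C\<langle>Q1\<rangle> \<boxplus> C\<langle>Q2\<rangle>\<rangle>) \<leadsto>[S] R \<rbrakk>
   \<Longrightarrow> Res x P (N\<langle>C\<langle>Q1 \<boxplus> Q2\<rangle>\<rangle>) \<leadsto>[S] R"
| Cong: "\<lbrakk> P \<equiv>\<^sub>s P'; P' \<leadsto>[S] Q'; Q' \<equiv>\<^sub>s Q \<rbrakk> \<Longrightarrow> P \<leadsto>[S] Q"
| Ctx_Res: "P \<leadsto>[S] P' \<Longrightarrow> Res x P Q \<leadsto>[S] Res x P' Q"
| Ctx_Par: "P \<leadsto>[S] P' \<Longrightarrow> P \<parallel> Q \<leadsto>[S] P' \<parallel> Q"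
| Ctx_Choice: "P \<leadsto>[S] P' \<Longrightarrow> P \<boxplus> Q \<leadsto>[S] P' \<boxplus> Q"


section \<open>Session types\<close>

datatype ty =
    One
  | Bot
  | Tensor ty ty
  | Parr ty ty
  | Plus "(label, ty) fmap"
  | With "(label, ty) fmap"
  | MayProduce ty                  (* unary \<open>&A\<close> *)
  | MayConsume ty                  (* unary \<open>\<oplus>A\<close> *)

primrec dual :: "ty \<Rightarrow> ty" where
  "dual One = Bot"
| "dual Bot = One"
| "dual (Tensor A B) = Parr (dual A) (dual B)"
| "dual (Parr A B) = Tensor (dual A) (dual B)"
| "dual (Plus As) = With (fmmap dual As)"
| "dual (With As) = Plus (fmmap dual As)"
| "dual (MayProduce A) = MayConsume (dual A)"
| "dual (MayConsume A) = MayProduce (dual A)"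

type_synonym tctx = "(name, ty) fmap"

definition disjoint :: "tctx \<Rightarrow> tctx \<Rightarrow> bool" where
  "disjoint \<Gamma> \<Delta> \<longleftrightarrow> fmdom \<Gamma> |\<inter>| fmdom \<Delta> = {||}"

inductive typed :: "proc \<Rightarrow> tctx \<Rightarrow> bool"  (infix "\<turnstile>" 50) where
  T_Cut:
  "\<lbrakk> P \<turnstile> fmupd x A \<Gamma>; Q \<turnstile> fmupd x (dual A) \<Delta>;
     x |\<notin>| fmdom \<Gamma>; x |\<notin>| fmdom \<Delta>; disjoint \<Gamma> \<Delta> \<rbrakk>
   \<Longrightarrow> Res x P Q \<turnstile> \<Gamma> ++\<^sub>f \<Delta>"
| T_Mix: "\<lbrakk> P \<turnstile> \<Gamma>; Q \<turnstile> \<Delta>; disjoint \<Gamma> \<Delta> \<rbrakk> \<Longrightarrow> P \<parallel> Q \<turnstile> \<Gamma> ++\<^sub>f \<Delta>"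
| T_Choice: "\<lbrakk> P \<turnstile> \<Gamma>; Q \<turnstile> \<Gamma> \<rbrakk> \<Longrightarrow> P \<boxplus> Q \<turnstile> \<Gamma>"
| T_Inact: "Inact \<turnstile> fmempty"
| T_Fwd: "x \<noteq> y \<Longrightarrow> Fwd x y \<turnstile> fmupd x A (fmupd y (dual A) fmempty)"
| T_Close: "Close x \<turnstile> fmupd x One fmempty"
| T_Wait: "\<lbrakk> P \<turnstile> \<Gamma>; x |\<notin>| fmdom \<Gamma> \<rbrakk> \<Longrightarrow> Wait x P \<turnstile> fmupd x Bot \<Gamma>"
| T_Out:
  "\<lbrakk> P \<turnstile> fmupd y A \<Gamma>; Q \<turnstile> fmupd x B \<Delta>;
     y |\<notin>| fmdom \<Gamma>; x |\<notin>| fmdom \<Gamma>; x |\<notin>| fmdom \<Delta>; disjoint \<Gamma> \<Delta> \<rbrakk>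
   \<Longrightarrow> Out x y P Q \<turnstile> fmupd x (Tensor A B) (\<Gamma> ++\<^sub>f \<Delta>)"
| T_Inp:
  "\<lbrakk> P \<turnstile> fmupd y A (fmupd x B \<Gamma>); x \<noteq> y; x |\<notin>| fmdom \<Gamma>; y |\<notin>| fmdom \<Gamma> \<rbrakk>
   \<Longrightarrow> Inp x y P \<turnstile> fmupd x (Parr A B) \<Gamma>"
| T_Sel:
  "\<lbrakk> P \<turnstile> fmupd x A \<Gamma>; fmlookup As j = Some A; x |\<notin>| fmdom \<Gamma> \<rbrakk>
   \<Longrightarrow> Sel x j P \<turnstile> fmupd x (Plus As) \<Gamma>"
| T_Branch:
  "\<lbrakk> fmdom B = fmdom As; x |\<notin>| fmdom \<Gamma>;
     \<And>i P A. fmlookup B i = Some P \<Longrightarrow> fmlookup As i = Some A \<Longrightarrow> P \<turnstile> fmupd x A \<Gamma> \<rbrakk>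
   \<Longrightarrow> Branch x B \<turnstile> fmupd x (With As) \<Gamma>"
| T_Avail:
  "\<lbrakk> P \<turnstile> fmupd x A \<Gamma>; x |\<notin>| fmdom \<Gamma> \<rbrakk> \<Longrightarrow> Avail x P \<turnstile> fmupd x (MayProduce A) \<Gamma>"
| T_Unavail: "Unavail x \<turnstile> fmupd x (MayProduce A) fmempty"
| T_Expect:
  "\<lbrakk> P \<turnstile> fmupd x A \<Gamma>; x |\<notin>| fmdom \<Gamma>; fmpred (\<lambda>y B. \<exists>B'. B = MayProduce B') \<Gamma> \<rbrakk>
   \<Longrightarrow> Expect x (fmdom \<Gamma>) P \<turnstile> fmupd x (MayConsume A) \<Gamma>"

end

theory Submission
  imports Defs
begin

text \<open>A closed process that is not congruent to inaction contains a closed connect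
  \<open>(\<nu>x)(P | Q)\<close>. By rule \<open>Res_Choice\<close>, the connect reduces if it does so after all active choices
  of \<open>P\<close> or \<open>Q\<close> have been distributed outwards. Each resulting alternative is choice-free with the
  single free name \<open>x\<close>, so either it reduces on its own, which suffices by the contextual rules, or
  it offers a prefix on \<open>x\<close>; a forwarder with an end bound by a connect always reduces.
  In particular no forwarder on \<open>x\<close> is left, which matters because \<open>Pre\<close> cannot discard alternatives next to a
  forwarder. If neither side reduces, all alternatives of both sides are thus prefixes on \<open>x\<close> of dual
  types, and the precongruence selects one prefix class on each side.\<close>

section \<open>Free names and typing\<close>

lemma finite_fn: "finite (fn P)"
proof (induction P)
  case (Branch x B)
  have "finite (fset (fmran B))" by simp
  moreover have "\<Union> (fmran' (fmmap fn B)) = (\<Union>P \<in> fmran' B. fn P)"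
    by (auto simp: fmran'_def)
  ultimately show ?case
    using Branch by (auto simp: fmran'_alt_def)
qed auto

lemma finite_bn: "finite (bn C)"
  by (induction C) auto

lemma fresh_name:
  assumes "finite (X :: name set)"
  obtains w where "w \<notin> X"
  using assms ex_new_if_finite infinite_UNIV_nat by blast

lemma dual_dual: "dual (dual A) = A"
proof (induction A)
  case (Plus As)
  have "fmmap (dual \<circ> dual) As = fmmap id As"
    by (rule fmap.map_cong) (use Plus in auto)
  then show ?case by (simp add: fmap.map_comp fmap.map_id)
next
  case (With As)
  have "fmmap (dual \<circ> dual) As = fmmap id As"
    by (rule fmap.map_cong) (use With in auto)
  then show ?case by (simp add: fmap.map_comp fmap.map_id)
qed auto

text \<open>Equality fails: a branch without labels is typable in any context.\<close>

lemma fn_typed: "P \<turnstile> \<Gamma> \<Longrightarrow> fn P \<subseteq> fset (fmdom \<Gamma>)"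
proof (induction rule: typed.induct)
  case (T_Branch B As x \<Gamma>)
  have "fn P \<subseteq> insert x (fset (fmdom \<Gamma>))" if "P \<in> fmran' B" for P
  proof -
    from that obtain i where i: "fmlookup B i = Some P" by (auto simp: fmran'_def)
    then have "i |\<in>| fmdom As" using T_Branch.hyps(1) by (metis fmdomI)
    then obtain A where "fmlookup As i = Some A" by (meson fmlookup_dom_iff)
    with T_Branch.IH[OF i] show ?thesis by auto
  qed
  then show ?case by (fastforce simp: fmran'_def)
qed auto

lemma disjoint_sym: "disjoint \<Gamma> \<Delta> \<Longrightarrow> disjoint \<Delta> \<Gamma>"
  unfolding disjoint_def by auto

lemma disjoint_lookup: "disjoint \<Gamma> \<Delta> \<Longrightarrow> fmlookup \<Gamma> x = None \<or> fmlookup \<Delta> x = None"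
  unfolding disjoint_def by (metis finterI fmdom_notD fempty_iff)

lemma fmadd_comm:
  assumes "disjoint \<Gamma> \<Delta>"
  shows "\<Gamma> ++\<^sub>f \<Delta> = \<Delta> ++\<^sub>f \<Gamma>"
proof (rule fmap_ext)
  fix x
  show "fmlookup (\<Gamma> ++\<^sub>f \<Delta>) x = fmlookup (\<Delta> ++\<^sub>f \<Gamma>) x"
    using disjoint_lookup[OF assms, of x] by (auto simp: fmlookup_dom_iff)
qed

section \<open>Free names and types of the process in a hole\<close>

lemma fn_fill: "fn R - bn C \<subseteq> fn C\<langle>R\<rangle>"
  by (induction C) auto

text \<open>By \<open>fn_fill\<close> and \<open>fn_typed\<close>, x lies in the context of the
  component that holds the hole, and disjointness keeps it out of the other component. So its type
  is passed inwards unchanged; at a connect, \<open>x \<notin> bn C\<close> makes x differ from the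
  cut name.\<close>

lemma fill_typed:
  assumes "C\<langle>R\<rangle> \<turnstile> \<Gamma>" "dctx C" "x \<notin> bn C" "x \<in> fn R" "fmlookup \<Gamma> x = Some A"
  shows "\<exists>\<Gamma>'. R \<turnstile> \<Gamma>' \<and> fmlookup \<Gamma>' x = Some A"
  using assms
proof (induction C arbitrary: \<Gamma>)
  case Hole
  then show ?case by auto
next
  case (CPar C Q)
  from CPar.prems(1) obtain \<Gamma>1 \<Gamma>2 where G: "\<Gamma> = \<Gamma>1 ++\<^sub>f \<Gamma>2" "C\<langle>R\<rangle> \<turnstile> \<Gamma>1" "disjoint \<Gamma>1 \<Gamma>2"
    by (auto elim: typed.cases)
  have "x \<in> fset (fmdom \<Gamma>1)" using CPar.prems fn_fill[of R C] fn_typed[OF G(2)] by auto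
  moreover from this have "x |\<notin>| fmdom \<Gamma>2" using G(3) by (auto simp: disjoint_def)
  ultimately have "fmlookup \<Gamma>1 x = Some A" using CPar.prems(5) G(1) by simp
  then show ?case using CPar.IH[OF G(2)] CPar.prems by simp
next
  case (CRes u C Q)
  from CRes.prems(1) obtain B \<Gamma>1 \<Gamma>2 where G: "\<Gamma> = \<Gamma>1 ++\<^sub>f \<Gamma>2" "C\<langle>R\<rangle> \<turnstile> fmupd u B \<Gamma>1" "disjoint \<Gamma>1 \<Gamma>2"
    by (auto elim: typed.cases)
  have "x \<in> fset (fmdom \<Gamma>1)" using CRes.prems fn_fill[of R C] fn_typed[OF G(2)] by auto
  moreover from this have "x |\<notin>| fmdom \<Gamma>2" using G(3) by (auto simp: disjoint_def)
  ultimately have "fmlookup (fmupd u B \<Gamma>1) x = Some A" using CRes.prems(3,5) G(1) by simp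
  then show ?case using CRes.IH[OF G(2)] CRes.prems by simp
qed auto


section \<open>Renaming the binders of a D-context\<close>

lemmas [trans] = scong.trans

lemma cong_fill: "P \<equiv>\<^sub>s Q \<Longrightarrow> C\<langle>P\<rangle> \<equiv>\<^sub>s C\<langle>Q\<rangle>"
  by (induction C) (auto intro: scong.refl scong.cong_par scong.cong_res scong.cong_choice)

text \<open>Since \<sigma> fixes each binder of C and maps no other name to it, \<open>avoid\<close>
  keeps every binder and the update at a binder is trivial. The substitution thus reaches the hole
  unaltered.\<close>

lemma subst_fill:
  assumes "\<forall>y \<in> bn C. \<forall>z. \<sigma> z = y \<longleftrightarrow> z = y"
  shows "\<exists>C'. bn C' = bn C \<and> (dctx C \<longrightarrow> dctx C') \<and> subst C\<langle>R\<rangle> \<sigma> = C'\<langle>subst R \<sigma>\<rangle>"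
  using assms
proof (induction C)
  case Hole
  show ?case by (rule exI[of _ Hole]) simp
next
  case (CPar C Q)
  then obtain C' where "bn C' = bn C" "dctx C \<longrightarrow> dctx C'" "subst C\<langle>R\<rangle> \<sigma> = C'\<langle>subst R \<sigma>\<rangle>"
    by auto
  then show ?case by (intro exI[of _ "CPar C' (subst Q \<sigma>)"]) simp
next
  case (CChoice C Q)
  then obtain C' where "bn C' = bn C" "dctx C \<longrightarrow> dctx C'" "subst C\<langle>R\<rangle> \<sigma> = C'\<langle>subst R \<sigma>\<rangle>"
    by auto
  then show ?case by (intro exI[of _ "CChoice C' (subst Q \<sigma>)"]) simp
next
  case (CRes y C Q)
  then obtain C' where C': "bn C' = bn C" "dctx C \<longrightarrow> dctx C'" "subst C\<langle>R\<rangle> \<sigma> = C'\<langle>subst R \<sigma>\<rangle>"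
    by auto
  have y: "\<sigma> z = y \<longleftrightarrow> z = y" for z using CRes.prems by simp
  then have "\<sigma>(y := y) = \<sigma>" by (metis fun_upd_triv)
  moreover have "avoid y (\<sigma> ` (X - {y})) = y" for X using y by (auto simp: avoid_def)
  ultimately show ?case using C'
    by (intro exI[of _ "CRes y C' (subst Q \<sigma>)"]) (simp add: Let_def)
qed

text \<open>The invariant \<open>K\<close> records the shape of the process in the hole.\<close>

lemma fill_fresh:
  assumes "finite X" "dctx C" "K R"
    and "\<And>R u v. u \<in> bn C \<Longrightarrow> v \<notin> X \<Longrightarrow> K R \<Longrightarrow> K (R\<lbrace>v/u\<rbrace>)"
  shows "\<exists>C' R'. C\<langle>R\<rangle> \<equiv>\<^sub>s C'\<langle>R'\<rangle> \<and> dctx C' \<and> bn C' \<inter> X = {} \<and> K R'"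
  using assms
proof (induction C arbitrary: X)
  case Hole
  show ?case using Hole by (intro exI[of _ Hole] exI[of _ R]) (auto intro: scong.refl)
next
  case (CPar C Q)
  then obtain C' R' where "C\<langle>R\<rangle> \<equiv>\<^sub>s C'\<langle>R'\<rangle>" "dctx C'" "bn C' \<inter> X = {}" "K R'"
    by (auto dest!: CPar.IH)
  then show ?case
    by (intro exI[of _ "CPar C' Q"] exI[of _ R']) (auto intro: scong.refl scong.cong_par)
next
  case (CRes u C Q)
  \<comment> \<open>Adding u to the names to be avoided keeps it out of the new binders; otherwise
    the renaming of u below would violate the hypothesis of \<open>subst_fill\<close>.\<close>
  have "\<exists>C' R'. C\<langle>R\<rangle> \<equiv>\<^sub>s C'\<langle>R'\<rangle> \<and> dctx C' \<and> bn C' \<inter> insert u X = {} \<and> K R'"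
    by (rule CRes.IH) (use CRes.prems in auto)
  then obtain C' R' where C': "C\<langle>R\<rangle> \<equiv>\<^sub>s C'\<langle>R'\<rangle>" "dctx C'" "bn C' \<inter> insert u X = {}" "K R'"
    by auto
  \<comment> \<open>Freshness for \<open>bn C'\<close> lets the substitution pass through C';
    freshness for the free names is the side condition of \<open>alpha_step\<close>.\<close>
  obtain v where v: "v \<notin> X \<union> bn C' \<union> fn C'\<langle>R'\<rangle> \<union> fn Q"
    by (rule fresh_name[of "X \<union> bn C' \<union> fn C'\<langle>R'\<rangle> \<union> fn Q"])
      (use CRes.prems(1) finite_fn finite_bn in auto)
  have "\<forall>y \<in> bn C'. \<forall>z. (id(u := v)) z = y \<longleftrightarrow> z = y" using v C'(3) by (auto split: if_splits)
  then obtain C'' where C'': "bn C'' = bn C'" "dctx C''" "C'\<langle>R'\<rangle>\<lbrace>v/u\<rbrace> = C''\<langle>R'\<lbrace>v/u\<rbrace>\<rangle>"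
    using subst_fill[of C' "id(u := v)" R'] C'(2) by blast
  have "(CRes u C Q)\<langle>R\<rangle> \<equiv>\<^sub>s Res u C'\<langle>R'\<rangle> Q"
    using C' by (auto intro: scong.refl scong.cong_res)
  also have "\<dots> \<equiv>\<^sub>s Res v (C'\<langle>R'\<rangle>\<lbrace>v/u\<rbrace>) (Q\<lbrace>v/u\<rbrace>)"
    using v by (auto intro!: scong.alpha alpha_step.intros)
  finally have "(CRes u C Q)\<langle>R\<rangle> \<equiv>\<^sub>s (CRes v C'' (Q\<lbrace>v/u\<rbrace>))\<langle>R'\<lbrace>v/u\<rbrace>\<rangle>" using C'' by simp
  moreover have "K (R'\<lbrace>v/u\<rbrace>)" 
    using v by (intro CRes.prems(4) C'(4)) auto
  ultimately show ?case using C' C'' v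
    by (intro exI[of _ "CRes v C'' (Q\<lbrace>v/u\<rbrace>)"] exI[of _ "R'\<lbrace>v/u\<rbrace>"]) auto
qed auto


section \<open>Finite choices\<close>

lemma choices_Cons: "Ps \<noteq> [] \<Longrightarrow> choices (P # Ps) = P \<boxplus> choices Ps"
  by (cases Ps) auto

lemma choices_append:
  "Ps \<noteq> [] \<Longrightarrow> Qs \<noteq> [] \<Longrightarrow> choices (Ps @ Qs) \<equiv>\<^sub>s choices Ps \<boxplus> choices Qs"
proof (induction Ps)
  case (Cons P Ps)
  show ?case
  proof (cases "Ps = []")
    case True
    then show ?thesis using Cons by (auto simp: choices_Cons intro: scong.refl)
  next
    case False
    then have "choices ((P # Ps) @ Qs) \<equiv>\<^sub>s P \<boxplus> (choices Ps \<boxplus> choices Qs)"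
      using Cons by (auto simp: choices_Cons intro: scong.cong_choice scong.refl)
    also have "\<dots> \<equiv>\<^sub>s (P \<boxplus> choices Ps) \<boxplus> choices Qs"
      by (rule scong.sym[OF scong.choice_assoc])
    finally show ?thesis using False by (simp add: choices_Cons)
  qed
qed auto

lemma choices_cong: "list_all2 (\<equiv>\<^sub>s) Ps Qs \<Longrightarrow> choices Ps \<equiv>\<^sub>s choices Qs"
proof (induction rule: list_all2_induct)
  case Nil
  show ?case by (auto intro: scong.refl)
next
  case (Cons P Ps Q Qs)
  then have "Ps = [] \<longleftrightarrow> Qs = []" by auto
  with Cons show ?case by (cases "Ps = []") (auto simp: choices_Cons intro: scong.cong_choice)
qed

lemma choices_move: "choices (P # Ps @ Qs) \<equiv>\<^sub>s choices (Ps @ P # Qs)"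
proof (cases "Ps = []")
  case True
  then show ?thesis by (auto intro: scong.refl)
next
  case False
  show ?thesis
  proof (cases "Qs = []")
    case True
    have "choices (P # Ps) \<equiv>\<^sub>s choices Ps \<boxplus> choices [P]"
      using False by (auto simp: choices_Cons intro: scong.choice_comm)
    also have "\<dots> \<equiv>\<^sub>s choices (Ps @ [P])"
      using False by (intro scong.sym[OF choices_append]) auto
    finally show ?thesis using True by simp
  next
    case Qs: False
    have "choices (P # Ps @ Qs) \<equiv>\<^sub>s choices (P # Ps) \<boxplus> choices Qs"
      using choices_append[of "P # Ps" Qs] Qs by simp
    also have "\<dots> \<equiv>\<^sub>s (choices Ps \<boxplus> P) \<boxplus> choices Qs"
      using False by (auto simp: choices_Cons intro: scong.cong_choice scong.choice_comm scong.refl)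
    also have "\<dots> \<equiv>\<^sub>s choices Ps \<boxplus> choices (P # Qs)"
      using Qs by (auto simp: choices_Cons intro: scong.choice_assoc)
    also have "\<dots> \<equiv>\<^sub>s choices (Ps @ P # Qs)"
      using False by (intro scong.sym[OF choices_append]) auto
    finally show ?thesis .
  qed
qed

lemma choices_Cons_cong:
  assumes "choices Ps \<equiv>\<^sub>s choices Qs" "Ps = [] \<longleftrightarrow> Qs = []"
  shows "choices (P # Ps) \<equiv>\<^sub>s choices (P # Qs)"
  using assms by (cases "Ps = []") (auto simp: choices_Cons intro: scong.cong_choice scong.refl)

text \<open>\<open>precong_single\<close> expects the kept alternatives in front of the discarded
  ones; \<open>choices_move\<close> permits this sorting.\<close>

lemma choices_partition:
  "choices (map f xs) \<equiv>\<^sub>s choices (map f (filter p xs) @ map f (filter (\<lambda>x. \<not> p x) xs))"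
proof (induction xs)
  case Nil
  show ?case by (auto intro: scong.refl)
next
  case (Cons x xs)
  have empty: "map f xs = [] \<longleftrightarrow> map f (filter p xs) @ map f (filter (\<lambda>x. \<not> p x) xs) = []"
    by (cases xs) simp_all
  have "choices (map f (x # xs)) \<equiv>\<^sub>s
    choices (f x # map f (filter p xs) @ map f (filter (\<lambda>x. \<not> p x) xs))"
    using choices_Cons_cong[OF Cons empty] by simp
  also have "\<dots> \<equiv>\<^sub>s
    choices (map f (filter p (x # xs)) @ map f (filter (\<lambda>x. \<not> p x) (x # xs)))"
    by (auto intro: scong.refl choices_move)
  finally show ?case .
qed

text \<open>The means by which a family is brought, alternative by alternative, into a form g with a
  side condition \<Phi>.\<close>

lemma choices_obtain:
  assumes "\<forall>a \<in> set as. \<exists>c. f a \<equiv>\<^sub>s g c \<and> \<Phi> c" "as \<noteq> []"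
  obtains cs where "cs \<noteq> []" "choices (map f as) \<equiv>\<^sub>s choices (map g cs)" "\<forall>c \<in> set cs. \<Phi> c"
proof -
  from assms(1) obtain h where h: "\<forall>a \<in> set as. f a \<equiv>\<^sub>s g (h a) \<and> \<Phi> (h a)" by metis
  show thesis
  proof
    show "map h as \<noteq> []" using assms(2) by simp
    show "choices (map f as) \<equiv>\<^sub>s choices (map g (map h as))"
      using h by (intro choices_cong) (auto simp: list_all2_conv_all_nth)
  qed (use h in auto)
qed


section \<open>Reducibility\<close>

definition reduces :: "proc \<Rightarrow> bool" where
  "reduces P \<longleftrightarrow> (\<exists>Q S. S \<noteq> {} \<and> P \<leadsto>[S] Q)"

lemma reduces_cong: "P \<equiv>\<^sub>s Q \<Longrightarrow> reduces Q \<Longrightarrow> reduces P"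
  unfolding reduces_def by (blast intro: red.Cong scong.refl)

lemma reduces_res: "reduces P \<Longrightarrow> reduces (Res x P Q)"
  unfolding reduces_def by (blast intro: red.Ctx_Res)

lemma reduces_res': "reduces Q \<Longrightarrow> reduces (Res x P Q)"
  by (rule reduces_cong[OF scong.res_comm reduces_res])

lemma reduces_par: "reduces P \<Longrightarrow> reduces (P \<parallel> Q)"
  unfolding reduces_def by (blast intro: red.Ctx_Par)

lemma reduces_par': "reduces Q \<Longrightarrow> reduces (P \<parallel> Q)"
  by (rule reduces_cong[OF scong.par_comm reduces_par])

lemma reduces_choice: "reduces P \<Longrightarrow> reduces (P \<boxplus> Q)"
  unfolding reduces_def by (blast intro: red.Ctx_Choice)

lemma reduces_choice': "reduces Q \<Longrightarrow> reduces (P \<boxplus> Q)"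
  by (rule reduces_cong[OF scong.choice_comm reduces_choice])

lemma reduces_choices: "P \<in> set Ps \<Longrightarrow> reduces P \<Longrightarrow> reduces (choices Ps)"
proof (induction Ps)
  case (Cons Q Ps)
  then show ?case
    by (cases "Ps = []") (auto simp: choices_Cons intro: reduces_choice reduces_choice')
qed auto

section \<open>Interaction of two families of prefixes\<close>

text \<open>The condition \<open>sub \<alpha> = {x}\<close> shuts out typable forwarders, whose two
  ends differ. The type of x is recorded at the hole because it determines the form of the
  prefix.\<close>

definition exposes :: "name \<Rightarrow> ty \<Rightarrow> proc \<Rightarrow> bool" where
  "exposes x A P \<longleftrightarrow> (\<exists>C \<alpha> R \<Gamma>. P \<equiv>\<^sub>s C\<langle>R\<rangle> \<and> dctx C \<and> x \<notin> bn C \<and> prefixed \<alpha> R \<and>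
     sub \<alpha> = {x} \<and> R \<turnstile> \<Gamma> \<and> fmlookup \<Gamma> x = Some A)"

text \<open>The data behind \<open>exposes\<close>, packed as a triple in the format of the lists in
  \<open>precong_single\<close>.\<close>

definition entry :: "name \<Rightarrow> ty \<Rightarrow> ctx \<times> prefix \<times> proc \<Rightarrow> bool" where
  "entry x A = (\<lambda>(C, \<alpha>, R). dctx C \<and> x \<notin> bn C \<and> prefixed \<alpha> R \<and> sub \<alpha> = {x} \<and>
     (\<exists>\<Gamma>. R \<turnstile> \<Gamma> \<and> fmlookup \<Gamma> x = Some A))"

abbreviation plug :: "ctx \<times> prefix \<times> proc \<Rightarrow> proc" where
  "plug \<equiv> \<lambda>(C, \<alpha>, R). C\<langle>R\<rangle>"

lemma prefixed_fn: "prefixed \<alpha> R \<Longrightarrow> sub \<alpha> \<subseteq> fn R"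
  by (cases rule: prefixed.cases) auto

section \<open>Classes of prefixes\<close>

lemma bowtie_sym: "\<alpha> \<bowtie> \<beta> \<Longrightarrow> \<beta> \<bowtie> \<alpha>"
  by (cases rule: bowtie.cases) (auto intro: bowtie.intros)

lemma bowtie_trans: "\<alpha> \<bowtie> \<beta> \<Longrightarrow> \<beta> \<bowtie> \<gamma> \<Longrightarrow> \<alpha> \<bowtie> \<gamma>"
  by (auto elim!: bowtie.cases intro: bowtie.intros)

inductive_cases bowtieE:
  "PClose x \<bowtie> \<beta>" "PWait x \<bowtie> \<beta>" "POut x y \<bowtie> \<beta>" "PInp x y \<bowtie> \<beta>" "PSel x l \<bowtie> \<beta>"
  "PBranch x \<bowtie> \<beta>" "PAvail x \<bowtie> \<beta>" "PUnavail x \<bowtie> \<beta>" "PExpect x W \<bowtie> \<beta>"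

inductive_cases prefixedE:
  "prefixed (PClose x) R" "prefixed (PWait x) R" "prefixed (POut x y) R" "prefixed (PInp x y) R"
  "prefixed (PSel x l) R" "prefixed (PBranch x) R" "prefixed (PAvail x) R"
  "prefixed (PUnavail x) R" "prefixed (PExpect x W) R" "prefixed (PFwd x y) R"

inductive_cases prefixed_formE:
  "prefixed \<alpha> (Close x)" "prefixed \<alpha> (Wait x P)" "prefixed \<alpha> (Out x y P Q)"
  "prefixed \<alpha> (Inp x y P)" "prefixed \<alpha> (Sel x l P)" "prefixed \<alpha> (Branch x B)"
  "prefixed \<alpha> (Avail x P)" "prefixed \<alpha> (Unavail x)" "prefixed \<alpha> (Expect x W P)"
  "prefixed \<alpha> (Fwd x y)" "prefixed \<alpha> (Res x P Q)" "prefixed \<alpha> (P \<parallel> Q)"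
  "prefixed \<alpha> (P \<boxplus> Q)" "prefixed \<alpha> Inact"

text \<open>Inversion of typing: apart from the forwarder, which \<open>sub \<alpha> = {x}\<close>
  excludes, each prefix introduces one type constructor at its subject. The label sets are kept
  since the axiom \<open>Sel\<close> needs them.\<close>

lemma head_form:
  assumes "R \<turnstile> \<Gamma>" "prefixed \<alpha> R" "sub \<alpha> = {x}" "fmlookup \<Gamma> x = Some A"
  shows "case A of
      One \<Rightarrow> \<alpha> = PClose x
    | Bot \<Rightarrow> \<alpha> = PWait x
    | Tensor B C \<Rightarrow> (\<exists>y. \<alpha> = POut x y)
    | Parr B C \<Rightarrow> (\<exists>y. \<alpha> = PInp x y)
    | Plus As \<Rightarrow> (\<exists>l. \<alpha> = PSel x l \<and> l |\<in>| fmdom As)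
    | With As \<Rightarrow> \<alpha> = PBranch x \<and> (\<exists>B. R = Branch x B \<and> fmdom B = fmdom As)
    | MayProduce B \<Rightarrow> \<alpha> = PAvail x \<or> \<alpha> = PUnavail x
    | MayConsume B \<Rightarrow> (\<exists>W. \<alpha> = PExpect x W)"
  using assms by (cases rule: typed.cases) (auto elim!: prefixed_formE simp: fmlookup_dom_iff)

text \<open>Because \<bowtie> is an equivalence, one of its classes can be kept and all other
  entries discarded; these still have x free, as \<open>precong_single\<close> requires. A
  representative \<alpha>, R is returned with its typing so that \<open>head_form\<close> applies to
  it.\<close>

lemma select:
  assumes "Ps \<noteq> []" "\<forall>P \<in> set Ps. exposes x A P"
  obtains P' es \<alpha> R \<Gamma> where "choices Ps \<equiv>\<^sub>s P'" "precong {x} P' (choices (map plug es))" "es \<noteq> []"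
    "\<forall>e \<in> set es. entry x A e \<and> \<alpha> \<bowtie> fst (snd e)"
    "prefixed \<alpha> R" "sub \<alpha> = {x}" "R \<turnstile> \<Gamma>" "fmlookup \<Gamma> x = Some A"
proof -
  have "\<forall>P \<in> set Ps. \<exists>e. id P \<equiv>\<^sub>s plug e \<and> entry x A e"
    using assms(2) unfolding exposes_def entry_def by fastforce
  then obtain es where es: "es \<noteq> []" "choices (map id Ps) \<equiv>\<^sub>s choices (map plug es)"
    "\<forall>e \<in> set es. entry x A e"
    by (rule choices_obtain[OF _ assms(1)])
  \<comment> \<open>The class of the first entry is kept, so it is certainly non-empty.\<close>
  obtain C \<alpha> R where "hd es = (C, \<alpha>, R)" by (rule prod_cases3)
  then have hd: "(C, \<alpha>, R) \<in> set es" using hd_in_set[OF es(1)] by simp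
  define p where "p = (\<lambda>e :: ctx \<times> prefix \<times> proc. \<alpha> \<bowtie> fst (snd e))"
  have "p (C, \<alpha>, R)" by (simp add: p_def bowtie.intros)
  with hd have nonempty: "filter p es \<noteq> []" by (auto simp: filter_empty_conv)
  show thesis
  proof
    show "choices Ps \<equiv>\<^sub>s
      choices (map plug (filter p es) @ map plug (filter (\<lambda>e. \<not> p e) es))"
      using scong.trans[OF es(2) choices_partition] by (simp only: list.map_id)
    show "precong {x}
      (choices (map plug (filter p es) @ map plug (filter (\<lambda>e. \<not> p e) es)))
      (choices (map plug (filter p es)))"
    proof (rule precong_single)
      show "filter p es \<noteq> []" by (rule nonempty)
      show "\<forall>(C, \<alpha>, R) \<in> set (filter p es). dctx C \<and> x \<notin> bn C \<and> prefixed \<alpha> R \<and> sub \<alpha> = {x}"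
        using es(3) by (auto simp: entry_def)
      show "\<forall>(D, \<beta>, R) \<in> set (filter (\<lambda>e. \<not> p e) es).
          dctx D \<and> x \<notin> bn D \<and> prefixed \<beta> R \<and> x \<in> fn R"
        using es(3) prefixed_fn by (fastforce simp: entry_def)
    qed (auto simp: p_def dest: bowtie_sym intro: bowtie_trans)
    show "filter p es \<noteq> []" by (rule nonempty)
    show "\<forall>e \<in> set (filter p es). entry x A e \<and> \<alpha> \<bowtie> fst (snd e)"
      using es(3) by (simp add: p_def)
    from hd es(3) have e: "entry x A (C, \<alpha>, R)" by blast
    then show "prefixed \<alpha> R" "sub \<alpha> = {x}" by (auto simp: entry_def)
    \<comment> \<open>\<open>entry\<close> only asserts that a context exists; the choice operator
      names one as witness.\<close>
    show "R \<turnstile> (SOME \<Gamma>. R \<turnstile> \<Gamma> \<and> fmlookup \<Gamma> x = Some A)"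
      "fmlookup (SOME \<Gamma>. R \<turnstile> \<Gamma> \<and> fmlookup \<Gamma> x = Some A) x = Some A"
      using e someI_ex[of "\<lambda>\<Gamma>. R \<turnstile> \<Gamma> \<and> fmlookup \<Gamma> x = Some A"] by (auto simp: entry_def)
  qed
qed

text \<open>Turns a selected class into the format of a reduction axiom: h builds the prefixed
  process from its parameters c, and \<Psi> carries what the axiom demands of them.\<close>

lemma class_form:
  assumes "es \<noteq> []" "\<forall>e \<in> set es. entry x A e \<and> \<alpha> \<bowtie> fst (snd e)"
    and "\<And>\<beta> R \<Gamma>. \<alpha> \<bowtie> \<beta> \<Longrightarrow> prefixed \<beta> R \<Longrightarrow> sub \<beta> = {x} \<Longrightarrow> R \<turnstile> \<Gamma> \<Longrightarrow>
      fmlookup \<Gamma> x = Some A \<Longrightarrow> \<exists>c. R = h c \<and> \<Psi> c"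
  obtains cs where "cs \<noteq> []" "choices (map plug es) \<equiv>\<^sub>s choices (map (\<lambda>(C, c). C\<langle>h c\<rangle>) cs)"
    "\<forall>(C, c) \<in> set cs. dctx C \<and> x \<notin> bn C \<and> \<Psi> c"
proof -
  have "\<forall>e \<in> set es. \<exists>Cc. plug e \<equiv>\<^sub>s (\<lambda>(C, c). C\<langle>h c\<rangle>) Cc \<and>
      (\<lambda>(C, c). dctx C \<and> x \<notin> bn C \<and> \<Psi> c) Cc"
  proof
    fix e assume e: "e \<in> set es"
    obtain C \<beta> R where e_eq: "e = (C, \<beta>, R)" by (cases e)
    with assms(2) e obtain c where "R = h c" "\<Psi> c"
      using assms(3)[of \<beta> R] by (fastforce simp: entry_def)
    then show "\<exists>Cc. plug e \<equiv>\<^sub>s (\<lambda>(C, c). C\<langle>h c\<rangle>) Cc \<and>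
        (\<lambda>(C, c). dctx C \<and> x \<notin> bn C \<and> \<Psi> c) Cc"
      using e_eq e assms(2) by (intro exI[of _ "(C, c)"]) (auto simp: entry_def intro: scong.refl)
  qed
  from choices_obtain[OF this assms(1)] obtain cs where "cs \<noteq> []"
    "choices (map plug es) \<equiv>\<^sub>s choices (map (\<lambda>(C, c). C\<langle>h c\<rangle>) cs)"
    "\<forall>c \<in> set cs. (\<lambda>(C, c). dctx C \<and> x \<notin> bn C \<and> \<Psi> c) c" .
  then show thesis by (rule that)
qed

section \<open>Reduction axioms applied to selected classes\<close>

lemma reduces_resI:
  assumes "P \<equiv>\<^sub>s P'" "precong {x} P' P1" "P1 \<equiv>\<^sub>s P2" "Q \<equiv>\<^sub>s Q'" "precong {x} Q' Q1" "Q1 \<equiv>\<^sub>s Q2"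
    and "Res x P2 Q2 \<leadsto>[{x}] R"
  shows "reduces (Res x P Q)"
proof -
  have "Res x P1 Q1 \<leadsto>[{x}] R"
    using assms by (blast intro: red.Cong scong.cong_res scong.refl)
  then have "Res x P' Q' \<leadsto>[{x}] R" using assms by (blast intro: red.Pre)
  then have "Res x P Q \<leadsto>[{x}] R"
    using assms by (blast intro: red.Cong scong.cong_res scong.refl)
  then show ?thesis unfolding reduces_def by blast
qed

text \<open>\<open>class_form\<close> yields pairs, whereas the axiom indexes the closing side by
  contexts alone; the second component is a dummy of type \<open>unit\<close>.\<close>

lemma reducts_close:
  assumes "cs \<noteq> []" "ds \<noteq> []" "\<forall>(C, c :: unit) \<in> set cs. dctx C \<and> x \<notin> bn C"
    "\<forall>(D, Q) \<in> set ds. dctx D \<and> x \<notin> bn D"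
  shows "\<exists>R. Res x (choices (map (\<lambda>(C, c). C\<langle>Close x\<rangle>) cs))
    (choices (map (\<lambda>(D, Q). D\<langle>Wait x Q\<rangle>) ds)) \<leadsto>[{x}] R"
  using red.Close[of "map fst cs" ds x] assms by (fastforce simp: case_prod_unfold comp_def)

lemma reducts_none:
  assumes "cs \<noteq> []" "ds \<noteq> []" "\<forall>(C, c :: unit) \<in> set cs. dctx C \<and> x \<notin> bn C"
    "\<forall>(D, Q) \<in> set ds. dctx D \<and> x \<notin> bn D"
  shows "\<exists>R. Res x (choices (map (\<lambda>(C, c). C\<langle>Unavail x\<rangle>) cs))
    (choices (map (\<lambda>(D, Q). D\<langle>Expect x W Q\<rangle>) ds)) \<leadsto>[{x}] R"
  using red.None[of "map fst cs" ds x] assms by (fastforce simp: case_prod_unfold comp_def)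

lemma finite_fresh:
  assumes "\<forall>c \<in> set cs. finite (f c :: name set)" "finite X"
  obtains w where "w \<notin> X" "\<forall>c \<in> set cs. w \<notin> f c"
proof -
  have "finite (X \<union> (\<Union>c \<in> set cs. f c))" using assms by auto
  from fresh_name[OF this] show thesis using that by auto
qed

text \<open>\<open>Comm\<close> wants one bound name z for all inputs, output contexts whose binders
  avoid the free names of the input side, and a fresh w. The first two are achieved by
  alpha-conversion in each alternative.\<close>

lemma reducts_comm:
  assumes "cs \<noteq> []" "ds \<noteq> []" "\<forall>(C, y, P, Q) \<in> set cs. dctx C \<and> x \<notin> bn C"
    "\<forall>(D, z, R) \<in> set ds. dctx D \<and> x \<notin> bn D"
  shows "\<exists>R. Res x (choices (map (\<lambda>(C, y, P, Q). C\<langle>Out x y P Q\<rangle>) cs))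
    (choices (map (\<lambda>(D, z, R). D\<langle>Inp x z R\<rangle>) ds)) \<leadsto>[{x}] R"
proof -
  obtain z where z: "\<forall>d \<in> set ds. z \<notin> fn (snd (snd d))"
    by (rule finite_fresh[of ds "\<lambda>d. fn (snd (snd d))" "{}"]) (auto simp: finite_fn)
  have "\<forall>d \<in> set ds. \<exists>d'. (\<lambda>(D, z, R). D\<langle>Inp x z R\<rangle>) d \<equiv>\<^sub>s (\<lambda>(D, R). D\<langle>Inp x z R\<rangle>) d' \<and>
      (\<lambda>(D, R). dctx D \<and> x \<notin> bn D) d'"
  proof
    fix d assume d: "d \<in> set ds"
    obtain D z' R where d_eq: "d = (D, z', R)" by (cases d)
    have "Inp x z' R \<equiv>\<^sub>s Inp x z (R\<lbrace>z/z'\<rbrace>)"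
      using z d d_eq by (auto intro!: scong.alpha alpha_step.intros)
    then show "\<exists>d'. (\<lambda>(D, z, R). D\<langle>Inp x z R\<rangle>) d \<equiv>\<^sub>s (\<lambda>(D, R). D\<langle>Inp x z R\<rangle>) d' \<and>
        (\<lambda>(D, R). dctx D \<and> x \<notin> bn D) d'"
      using d d_eq assms(4) by (intro exI[of _ "(D, R\<lbrace>z/z'\<rbrace>)"]) (auto intro: cong_fill)
  qed
  then obtain ds' where ds': "ds' \<noteq> []"
    "choices (map (\<lambda>(D, z, R). D\<langle>Inp x z R\<rangle>) ds) \<equiv>\<^sub>s choices (map (\<lambda>(D, R). D\<langle>Inp x z R\<rangle>) ds')"
    "\<forall>(D, R) \<in> set ds'. dctx D \<and> x \<notin> bn D"
    by (rule choices_obtain[OF _ assms(2)])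
  define T where "T = choices (map (\<lambda>(D, R). D\<langle>Inp x z R\<rangle>) ds')"
  have "\<forall>c \<in> set cs. \<exists>c'. (\<lambda>(C, y, P, Q). C\<langle>Out x y P Q\<rangle>) c \<equiv>\<^sub>s
      (\<lambda>(C, y, P, Q). C\<langle>Out x y P Q\<rangle>) c' \<and>
      (\<lambda>(C, y, P, Q). dctx C \<and> x \<notin> bn C \<and> bn C \<inter> fn T = {}) c'"
  proof
    fix c assume c: "c \<in> set cs"
    obtain C y P Q where c_eq: "c = (C, y, P, Q)" by (cases c)
    have C: "dctx C" "x \<notin> bn C" using assms(3) c c_eq by auto
    \<comment> \<open>The invariant is being an output on x. Only binders of C get renamed and x is
      not among them, so the subject survives.\<close>
    have "\<exists>C' R'. C\<langle>Out x y P Q\<rangle> \<equiv>\<^sub>s C'\<langle>R'\<rangle> \<and> dctx C' \<and> bn C' \<inter> (insert x (fn T)) = {} \<and>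
        (\<exists>y P Q. R' = Out x y P Q)"
    proof (rule fill_fresh)
      fix R u v assume "u \<in> bn C" "\<exists>y P Q. R = Out x y P Q"
      then show "\<exists>y P Q. R\<lbrace>v/u\<rbrace> = Out x y P Q" using C(2) by (auto simp: Let_def)
    qed (use C finite_fn in auto)
    then obtain C' y' P' Q' where "C\<langle>Out x y P Q\<rangle> \<equiv>\<^sub>s C'\<langle>Out x y' P' Q'\<rangle>" "dctx C'"
      "bn C' \<inter> (insert x (fn T)) = {}" by blast
    then show "\<exists>c'. (\<lambda>(C, y, P, Q). C\<langle>Out x y P Q\<rangle>) c \<equiv>\<^sub>s
        (\<lambda>(C, y, P, Q). C\<langle>Out x y P Q\<rangle>) c' \<and>
        (\<lambda>(C, y, P, Q). dctx C \<and> x \<notin> bn C \<and> bn C \<inter> fn T = {}) c'"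
      using c_eq by (intro exI[of _ "(C', y', P', Q')"]) auto
  qed
  then obtain cs' where cs': "cs' \<noteq> []"
    "choices (map (\<lambda>(C, y, P, Q). C\<langle>Out x y P Q\<rangle>) cs) \<equiv>\<^sub>s
      choices (map (\<lambda>(C, y, P, Q). C\<langle>Out x y P Q\<rangle>) cs')"
    "\<forall>(C, y, P, Q) \<in> set cs'. dctx C \<and> x \<notin> bn C \<and> bn C \<inter> fn T = {}"
    by (rule choices_obtain[OF _ assms(1)])
  obtain w where w: "w \<notin> fn T \<union> (\<Union>d \<in> set ds'. bn (fst d))"
    "\<forall>c \<in> set cs'. w \<notin> (\<lambda>(C, y, P, Q). fn (Out x y P Q)) c"
    by (rule finite_fresh[of cs' "\<lambda>(C, y, P, Q). fn (Out x y P Q)"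
          "fn T \<union> (\<Union>d \<in> set ds'. bn (fst d))"])
      (auto simp: finite_fn finite_bn)
  have "\<exists>R. Res x (choices (map (\<lambda>(C, y, P, Q). C\<langle>Out x y P Q\<rangle>) cs')) T \<leadsto>[{x}] R"
    by (rule exI, rule red.Comm[OF cs'(1) ds'(1) T_def]) (use cs'(3) ds'(3) w in auto)
  then show ?thesis using cs'(2) ds'(2) unfolding T_def
    by (blast intro: red.Cong scong.cong_res scong.refl)
qed

text \<open>The four types listed are those of the prefixes on the left in the axioms other than
  \<open>Id\<close>. \<open>head_form\<close> reads the matching prefixes off A and its dual, and
  \<open>class_form\<close> brings both selected classes into the shape of the axiom.\<close>

lemma reduces_interaction_positive:
  assumes "Ps \<noteq> []" "\<forall>P \<in> set Ps. exposes x A P" "Qs \<noteq> []" "\<forall>Q \<in> set Qs. exposes x (dual A) Q"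
    and A: "(case A of One \<Rightarrow> True | Tensor B C \<Rightarrow> True | Plus As \<Rightarrow> True | MayProduce B \<Rightarrow> True
      | _ \<Rightarrow> False)"
  shows "reduces (Res x (choices Ps) (choices Qs))"
proof -
  obtain P' es \<alpha> R1 \<Gamma>1 where P: "choices Ps \<equiv>\<^sub>s P'" "precong {x} P' (choices (map plug es))"
    and es: "es \<noteq> []" "\<forall>e \<in> set es. entry x A e \<and> \<alpha> \<bowtie> fst (snd e)"
    and \<alpha>: "prefixed \<alpha> R1" "sub \<alpha> = {x}" "R1 \<turnstile> \<Gamma>1" "fmlookup \<Gamma>1 x = Some A"
    using assms(1,2) by (rule select)
  obtain Q' fs \<beta> R2 \<Gamma>2 where Q: "choices Qs \<equiv>\<^sub>s Q'" "precong {x} Q' (choices (map plug fs))"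
    and fs: "fs \<noteq> []" "\<forall>e \<in> set fs. entry x (dual A) e \<and> \<beta> \<bowtie> fst (snd e)"
    and \<beta>: "prefixed \<beta> R2" "sub \<beta> = {x}" "R2 \<turnstile> \<Gamma>2" "fmlookup \<Gamma>2 x = Some (dual A)"
    using assms(3,4) by (rule select)
  note head = head_form[OF \<alpha>(3,1,2,4)] head_form[OF \<beta>(3,1,2,4)]
  have redI: "reduces (Res x (choices Ps) (choices Qs))"
    if "choices (map plug es) \<equiv>\<^sub>s P2" "choices (map plug fs) \<equiv>\<^sub>s Q2"
      "\<exists>R. Res x P2 Q2 \<leadsto>[{x}] R" for P2 Q2
    using that reduces_resI[OF P(1,2) that(1) Q(1,2) that(2)] by blast
  show ?thesis
  proof (cases A)
    case One
    then have ab: "\<alpha> = PClose x" "\<beta> = PWait x" using head by auto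
    obtain cs where cs: "cs \<noteq> []"
      "choices (map plug es) \<equiv>\<^sub>s choices (map (\<lambda>(C, c :: unit). C\<langle>Close x\<rangle>) cs)"
      "\<forall>(C, c) \<in> set cs. dctx C \<and> x \<notin> bn C \<and> True"
      by (rule class_form[OF es, of "\<lambda>_. Close x" "\<lambda>_. True"])
        (auto simp: ab elim!: bowtieE prefixedE)
    obtain ds where ds: "ds \<noteq> []"
      "choices (map plug fs) \<equiv>\<^sub>s choices (map (\<lambda>(C, Q). C\<langle>Wait x Q\<rangle>) ds)"
      "\<forall>(C, c) \<in> set ds. dctx C \<and> x \<notin> bn C \<and> True"
      by (rule class_form[OF fs, of "Wait x" "\<lambda>_. True"])
        (auto simp: ab elim!: bowtieE prefixedE)
    show ?thesis
      by (rule redI[OF cs(2) ds(2)], rule reducts_close) (use cs ds in auto)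
  next
    case (Tensor B1 B2)
    then obtain y z where ab: "\<alpha> = POut x y" "\<beta> = PInp x z" using head by auto
    obtain cs where cs: "cs \<noteq> []"
      "choices (map plug es) \<equiv>\<^sub>s choices (map (\<lambda>(C, c). C\<langle>(\<lambda>(y, P, Q). Out x y P Q) c\<rangle>) cs)"
      "\<forall>(C, c) \<in> set cs. dctx C \<and> x \<notin> bn C \<and> True"
      by (rule class_form[OF es, of "\<lambda>(y, P, Q). Out x y P Q" "\<lambda>_. True"])
        (auto simp: ab elim!: bowtieE prefixedE)
    obtain ds where ds: "ds \<noteq> []"
      "choices (map plug fs) \<equiv>\<^sub>s choices (map (\<lambda>(C, c). C\<langle>(\<lambda>(z, R). Inp x z R) c\<rangle>) ds)"
      "\<forall>(C, c) \<in> set ds. dctx C \<and> x \<notin> bn C \<and> True"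
      by (rule class_form[OF fs, of "\<lambda>(z, R). Inp x z R" "\<lambda>_. True"])
        (auto simp: ab elim!: bowtieE prefixedE)
    have "\<exists>R. Res x (choices (map (\<lambda>(C, y, P, Q). C\<langle>Out x y P Q\<rangle>) cs))
      (choices (map (\<lambda>(D, z, R). D\<langle>Inp x z R\<rangle>) ds)) \<leadsto>[{x}] R"
      by (rule reducts_comm) (use cs ds in auto)
    then show ?thesis
      by (intro redI[OF cs(2) ds(2)]) (simp add: case_prod_unfold)
  next
    case (Plus As)
    \<comment> \<open>Selections are related by \<bowtie> only if they coincide, so the whole class
      selects the same l.\<close>
    then obtain l where ab: "\<alpha> = PSel x l" "l |\<in>| fmdom As" "\<beta> = PBranch x" using head by auto
    obtain cs where cs: "cs \<noteq> []"
      "choices (map plug es) \<equiv>\<^sub>s choices (map (\<lambda>(C, P). C\<langle>Sel x l P\<rangle>) cs)"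
      "\<forall>(C, c) \<in> set cs. dctx C \<and> x \<notin> bn C \<and> True"
      by (rule class_form[OF es, of "Sel x l" "\<lambda>_. True"])
        (auto simp: ab elim!: bowtieE prefixedE)
    obtain ds where ds: "ds \<noteq> []"
      "choices (map plug fs) \<equiv>\<^sub>s choices (map (\<lambda>(C, B). C\<langle>Branch x B\<rangle>) ds)"
      "\<forall>(C, B) \<in> set ds. dctx C \<and> x \<notin> bn C \<and> fmdom B = fmdom As"
    proof (rule class_form[OF fs, of "Branch x" "\<lambda>B. fmdom B = fmdom As"])
      fix \<gamma> R \<Gamma>
      assume "prefixed \<gamma> R" "sub \<gamma> = {x}" "R \<turnstile> \<Gamma>" "fmlookup \<Gamma> x = Some (dual A)"
      \<comment> \<open>\<open>Sel\<close> asks for one label set shared by all branches; typing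
        provides it, since duality preserves the labels of As.\<close>
      from head_form[OF this(3,1,2,4)] show "\<exists>B. R = Branch x B \<and> fmdom B = fmdom As"
        using Plus by auto
    qed
    show ?thesis
      by (rule redI[OF cs(2) ds(2)], rule exI, rule red.Sel) (use cs ds ab in auto)
  next
    case (MayProduce B)
    \<comment> \<open>Likewise all expects of one class carry the same set W, as \<open>Some\<close>
      and \<open>None\<close> require.\<close>
    then obtain W where \<beta>': "\<beta> = PExpect x W" using head by auto
    obtain ds where ds: "ds \<noteq> []"
      "choices (map plug fs) \<equiv>\<^sub>s choices (map (\<lambda>(C, Q). C\<langle>Expect x W Q\<rangle>) ds)"
      "\<forall>(C, c) \<in> set ds. dctx C \<and> x \<notin> bn C \<and> True"
      by (rule class_form[OF fs, of "Expect x W" "\<lambda>_. True"])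
        (auto simp: \<beta>' elim!: bowtieE prefixedE)
    from MayProduce consider "\<alpha> = PAvail x" | "\<alpha> = PUnavail x" using head by auto
    then show ?thesis
    proof cases
      case 1
      obtain cs where cs: "cs \<noteq> []"
        "choices (map plug es) \<equiv>\<^sub>s choices (map (\<lambda>(C, P). C\<langle>Avail x P\<rangle>) cs)"
        "\<forall>(C, c) \<in> set cs. dctx C \<and> x \<notin> bn C \<and> True"
        by (rule class_form[OF es, of "Avail x" "\<lambda>_. True"])
          (auto simp: 1 elim!: bowtieE prefixedE)
      show ?thesis
        by (rule redI[OF cs(2) ds(2)], rule exI, rule red.Some) (use cs ds in auto)
    next
      case 2
      obtain cs where cs: "cs \<noteq> []"
        "choices (map plug es) \<equiv>\<^sub>s choices (map (\<lambda>(C, c :: unit). C\<langle>Unavail x\<rangle>) cs)"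
        "\<forall>(C, c) \<in> set cs. dctx C \<and> x \<notin> bn C \<and> True"
        by (rule class_form[OF es, of "\<lambda>_. Unavail x" "\<lambda>_. True"])
          (auto simp: 2 elim!: bowtieE prefixedE)
      show ?thesis
        by (rule redI[OF cs(2) ds(2)], rule reducts_none) (use cs ds in auto)
    qed
  qed (use A in auto)
qed

text \<open>Of A and its dual, one is among the four types of the previous lemma; in the other case
  the two sides of the connect are swapped.\<close>

lemma reduces_interaction:
  assumes "Ps \<noteq> []" "\<forall>P \<in> set Ps. exposes x A P" "Qs \<noteq> []" "\<forall>Q \<in> set Qs. exposes x (dual A) Q"
  shows "reduces (Res x (choices Ps) (choices Qs))"
proof (cases "case A of One \<Rightarrow> True | Tensor B C \<Rightarrow> True | Plus As \<Rightarrow> True | MayProduce B \<Rightarrow> True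
    | _ \<Rightarrow> False")
  case True
  with assms show ?thesis by (rule reduces_interaction_positive)
next
  case False
  then have "reduces (Res x (choices Qs) (choices Ps))"
    using assms by (intro reduces_interaction_positive[where A = "dual A"])
      (auto simp: dual_dual split: ty.splits)
  then show ?thesis by (rule reduces_cong[OF scong.res_comm])
qed

text \<open>The axiom \<open>Id\<close> for a single alternative. Its side condition on Q is met by
  renaming the binders of C, which leaves the forwarder intact because C binds neither end.\<close>

lemma reduces_fwd:
  assumes "dctx C" "x \<notin> bn C" "y \<notin> bn C" "x \<noteq> y"
  shows "reduces (Res x C\<langle>Fwd x y\<rangle> Q)"
proof -
  have "\<exists>C' R'. C\<langle>Fwd x y\<rangle> \<equiv>\<^sub>s C'\<langle>R'\<rangle> \<and> dctx C' \<and> bn C' \<inter> (insert x (fn Q)) = {} \<and> R' = Fwd x y"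
    by (rule fill_fresh) (use assms in \<open>auto simp: finite_fn\<close>)
  then obtain C' where C': "C\<langle>Fwd x y\<rangle> \<equiv>\<^sub>s C'\<langle>Fwd x y\<rangle>" "dctx C'" "bn C' \<inter> (insert x (fn Q)) = {}"
    by blast
  have "Res x (choices (map (\<lambda>C. C\<langle>Fwd x y\<rangle>) [C'])) Q \<leadsto>[{x, y}]
      choices (map (\<lambda>C. C\<langle>Q\<lbrace>y/x\<rbrace>\<rangle>) [C'])"
    by (rule red.Id) (use C'(2,3) assms(4) in auto)
  then have "Res x C'\<langle>Fwd x y\<rangle> Q \<leadsto>[{x, y}] C'\<langle>Q\<lbrace>y/x\<rbrace>\<rangle>" by (simp only: list.map choices.simps(2))
  then have "reduces (Res x C'\<langle>Fwd x y\<rangle> Q)"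
    unfolding reduces_def by (intro exI conjI) auto
  then show ?thesis by (rule reduces_cong[OF scong.cong_res[OF C'(1) scong.refl]])
qed

section \<open>Progress of choice-free processes\<close>

text \<open>Only active choices are excluded; below a prefix anything is allowed.\<close>

primrec choice_free :: "proc \<Rightarrow> bool" where
  "choice_free Inact \<longleftrightarrow> True"
| "choice_free (Fwd x y) \<longleftrightarrow> True"
| "choice_free (Res x P Q) \<longleftrightarrow> choice_free P \<and> choice_free Q"
| "choice_free (P \<boxplus> Q) \<longleftrightarrow> False"
| "choice_free (Out x y P Q) \<longleftrightarrow> True"
| "choice_free (Inp x y P) \<longleftrightarrow> True"
| "choice_free (Sel x l P) \<longleftrightarrow> True"
| "choice_free (Branch x B) \<longleftrightarrow> True"
| "choice_free (Close x) \<longleftrightarrow> True"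
| "choice_free (Wait x P) \<longleftrightarrow> True"
| "choice_free (Expect x W P) \<longleftrightarrow> True"
| "choice_free (Avail x P) \<longleftrightarrow> True"
| "choice_free (Unavail x) \<longleftrightarrow> True"
| "choice_free (P \<parallel> Q) \<longleftrightarrow> choice_free P \<and> choice_free Q"

definition ready :: "prefix \<Rightarrow> proc \<Rightarrow> tctx \<Rightarrow> bool" where
  "ready \<alpha> P \<Gamma> \<longleftrightarrow> (\<exists>C R. P \<equiv>\<^sub>s C\<langle>R\<rangle> \<and> C\<langle>R\<rangle> \<turnstile> \<Gamma> \<and> dctx C \<and> prefixed \<alpha> R \<and> sub \<alpha> \<inter> bn C = {})"

lemma ready_prefixed: "prefixed \<alpha> P \<Longrightarrow> P \<turnstile> \<Gamma> \<Longrightarrow> ready \<alpha> P \<Gamma>"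
  unfolding ready_def by (intro exI[of _ Hole] exI[of _ P]) (simp add: scong.refl)

lemma ready_cong: "P \<equiv>\<^sub>s Q \<Longrightarrow> ready \<alpha> Q \<Gamma> \<Longrightarrow> ready \<alpha> P \<Gamma>"
  unfolding ready_def by (blast intro: scong.trans)

lemma ready_sub: "ready \<alpha> P \<Gamma> \<Longrightarrow> sub \<alpha> \<subseteq> fset (fmdom \<Gamma>)"
proof -
  assume "ready \<alpha> P \<Gamma>"
  then obtain C R where "C\<langle>R\<rangle> \<turnstile> \<Gamma>" "prefixed \<alpha> R" "sub \<alpha> \<inter> bn C = {}"
    unfolding ready_def by blast
  then show ?thesis using fn_fill[of R C] fn_typed[of "C\<langle>R\<rangle>" \<Gamma>] prefixed_fn[of \<alpha> R] by blast
qed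

lemma ready_par:
  assumes "ready \<alpha> P \<Gamma>" "Q \<turnstile> \<Delta>" "disjoint \<Gamma> \<Delta>"
  shows "ready \<alpha> (P \<parallel> Q) (\<Gamma> ++\<^sub>f \<Delta>)"
proof -
  from assms(1) obtain C R where "P \<equiv>\<^sub>s C\<langle>R\<rangle>" "C\<langle>R\<rangle> \<turnstile> \<Gamma>" "dctx C" "prefixed \<alpha> R" "sub \<alpha> \<inter> bn C = {}"
    unfolding ready_def by blast
  then show ?thesis unfolding ready_def using assms(2,3)
    by (intro exI[of _ "CPar C Q"] exI[of _ R]) (simp add: T_Mix scong.cong_par scong.refl)
qed

lemma ready_res:
  assumes "ready \<alpha> P (fmupd x A \<Gamma>)" "x \<notin> sub \<alpha>" "Q \<turnstile> fmupd x (dual A) \<Delta>"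
    "x |\<notin>| fmdom \<Gamma>" "x |\<notin>| fmdom \<Delta>" "disjoint \<Gamma> \<Delta>"
  shows "ready \<alpha> (Res x P Q) (\<Gamma> ++\<^sub>f \<Delta>)"
proof -
  from assms(1) obtain C R where "P \<equiv>\<^sub>s C\<langle>R\<rangle>" "C\<langle>R\<rangle> \<turnstile> fmupd x A \<Gamma>" "dctx C" "prefixed \<alpha> R"
    "sub \<alpha> \<inter> bn C = {}"
    unfolding ready_def by blast
  then show ?thesis unfolding ready_def using assms(2-)
    by (intro exI[of _ "CRes x C Q"] exI[of _ R]) (simp add: T_Cut scong.cong_res scong.refl)
qed

text \<open>If x is not the sole subject, the prefix is a forwarder between x and another name, and
  any connect on x fires by \<open>reduces_fwd\<close>.\<close>

lemma ready_cases:
  assumes "ready \<alpha> P \<Gamma>" "x \<in> sub \<alpha>" "fmlookup \<Gamma> x = Some A"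
  shows "exposes x A P \<or> (\<forall>Q. reduces (Res x P Q))"
proof -
  from assms(1) obtain C R where C: "P \<equiv>\<^sub>s C\<langle>R\<rangle>" "C\<langle>R\<rangle> \<turnstile> \<Gamma>" "dctx C" "prefixed \<alpha> R"
    "sub \<alpha> \<inter> bn C = {}"
    unfolding ready_def by blast
  have x: "x \<notin> bn C" "x \<in> fn R" using assms(2) C(4,5) prefixed_fn by auto
  obtain \<Gamma>' where \<Gamma>': "R \<turnstile> \<Gamma>'" "fmlookup \<Gamma>' x = Some A"
    using fill_typed[OF C(2,3) x assms(3)] by blast
  show ?thesis
  proof (cases "sub \<alpha> = {x}")
    case True
    then show ?thesis using C x \<Gamma>' unfolding exposes_def by blast
  next
    case False
    then obtain a b where \<alpha>: "\<alpha> = PFwd a b" using assms(2) by (cases \<alpha>) auto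
    then have R: "R = Fwd a b" using C(4) by (auto elim: prefixedE)
    with \<Gamma>'(1) have ab: "a \<noteq> b" by (auto elim: typed.cases)
    \<comment> \<open>The forwarder is oriented so that x comes first.\<close>
    obtain y where y: "x \<noteq> y" "y \<notin> bn C" "R \<equiv>\<^sub>s Fwd x y"
    proof (cases "x = a")
      case True
      then show thesis using that[of b] R ab \<alpha> C(5) by (auto intro: scong.refl)
    next
      case False
      then have "x = b" using assms(2) \<alpha> by auto
      then show thesis using that[of a] R ab \<alpha> C(5) by (auto intro: scong.fwd_sym)
    qed
    have "P \<equiv>\<^sub>s C\<langle>Fwd x y\<rangle>" using C(1) cong_fill[OF y(3)] by (rule scong.trans)
    then have "reduces (Res x P Q)" for Q
      by (rule reduces_cong[OF scong.cong_res[OF _ scong.refl] reduces_fwd[OF C(3) x(1) y(2,1)]])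
    then show ?thesis by blast
  qed
qed

text \<open>In a connect, the cut name makes both contexts non-empty, so each irreducible side has a
  ready prefix. One whose subject avoids x stays ready outside; if both involve x, they interact or
  a forwarder fires. In a parallel composition one component with a non-empty context
  suffices.\<close>

lemma choice_free_progress:
  assumes "choice_free P" "P \<turnstile> \<Gamma>" "\<Gamma> \<noteq> fmempty"
  shows "reduces P \<or> (\<exists>\<alpha>. ready \<alpha> P \<Gamma>)"
  using assms
proof (induction P arbitrary: \<Gamma>)
  case Inact
  then show ?case by (auto elim: typed.cases)
next
  case (Res x P Q)
  from Res.prems(2) obtain A \<Gamma>1 \<Gamma>2 where G: "\<Gamma> = \<Gamma>1 ++\<^sub>f \<Gamma>2" and
    T: "P \<turnstile> fmupd x A \<Gamma>1" "Q \<turnstile> fmupd x (dual A) \<Gamma>2"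
    "x |\<notin>| fmdom \<Gamma>1" "x |\<notin>| fmdom \<Gamma>2" "disjoint \<Gamma>1 \<Gamma>2"
    by (cases rule: typed.cases) blast
  have ne: "fmupd x B \<Delta> \<noteq> fmempty" for B :: ty and \<Delta>
    by (metis fmempty_lookup fmupd_lookup option.distinct(1))
  show ?case
  proof (cases "reduces P \<or> reduces Q")
    case True
    then show ?thesis using reduces_res reduces_res' by blast
  next
    case False
    then obtain \<alpha> \<beta> where \<alpha>: "ready \<alpha> P (fmupd x A \<Gamma>1)" and \<beta>: "ready \<beta> Q (fmupd x (dual A) \<Gamma>2)"
      using Res.IH Res.prems(1) T(1,2) ne by (metis choice_free.simps(3))
    consider "x \<notin> sub \<alpha>" | "x \<notin> sub \<beta>" | "x \<in> sub \<alpha>" "x \<in> sub \<beta>" by blast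
    then show ?thesis
    proof cases
      case 1
      then show ?thesis using ready_res[OF \<alpha> _ T(2-)] G by blast
    next
      case 2
      then have "ready \<beta> (Res x Q P) (\<Gamma>2 ++\<^sub>f \<Gamma>1)"
        using \<beta> T disjoint_sym[OF T(5)] by (intro ready_res[where A = "dual A"]) (simp_all add: dual_dual)
      then show ?thesis using ready_cong[OF scong.res_comm] G fmadd_comm[OF T(5)] by metis
    next
      case 3
      have "exposes x A P \<or> (\<forall>Q. reduces (Res x P Q))"
        using ready_cases[OF \<alpha> 3(1)] by simp
      moreover have "exposes x (dual A) Q \<or> (\<forall>P. reduces (Res x Q P))"
        using ready_cases[OF \<beta> 3(2)] by simp
      moreover have "reduces (Res x P Q)" if "reduces (Res x Q P)"
        using that by (rule reduces_cong[OF scong.res_comm])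
      \<comment> \<open>Two families with a single alternative each.\<close>
      moreover have "reduces (Res x P Q)" if "exposes x A P" "exposes x (dual A) Q"
        using reduces_interaction[of "[P]" x A "[Q]"] that by simp
      ultimately show ?thesis by blast
    qed
  qed
next
  case (Par P Q)
  from Par.prems(2) obtain \<Gamma>1 \<Gamma>2 where G: "\<Gamma> = \<Gamma>1 ++\<^sub>f \<Gamma>2" and
    T: "P \<turnstile> \<Gamma>1" "Q \<turnstile> \<Gamma>2" "disjoint \<Gamma>1 \<Gamma>2"
    by (cases rule: typed.cases) blast
  have "\<Gamma>1 \<noteq> fmempty \<or> \<Gamma>2 \<noteq> fmempty" using Par.prems(3) G by auto
  then show ?case
  proof
    assume "\<Gamma>1 \<noteq> fmempty"
    then have "reduces P \<or> (\<exists>\<alpha>. ready \<alpha> P \<Gamma>1)" using Par.IH(1) Par.prems(1) T(1) by simp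
    then show ?thesis using reduces_par ready_par[OF _ T(2,3)] G by blast
  next
    assume "\<Gamma>2 \<noteq> fmempty"
    then have "reduces Q \<or> (\<exists>\<alpha>. ready \<alpha> Q \<Gamma>2)" using Par.IH(2) Par.prems(1) T(2) by simp
    then show ?thesis
    proof
      assume "\<exists>\<alpha>. ready \<alpha> Q \<Gamma>2"
      then obtain \<alpha> where "ready \<alpha> (Q \<parallel> P) (\<Gamma>2 ++\<^sub>f \<Gamma>1)"
        using ready_par[OF _ T(1) disjoint_sym[OF T(3)]] by blast
      then show ?thesis using ready_cong[OF scong.par_comm] G fmadd_comm[OF T(3)] by metis
    qed (blast intro: reduces_par')
  qed
next
  case (Out x y P Q)
  then show ?case by (blast intro: ready_prefixed prefixed.intros)
next
  case (Branch x B)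
  then show ?case by (blast intro: ready_prefixed prefixed.intros)
qed (auto intro: ready_prefixed prefixed.intros)


section \<open>Distributing choices\<close>

primrec ctx_comp :: "ctx \<Rightarrow> ctx \<Rightarrow> ctx" where
  "ctx_comp Hole M = M"
| "ctx_comp (CPar N Q) M = CPar (ctx_comp N M) Q"
| "ctx_comp (CRes x N Q) M = CRes x (ctx_comp N M) Q"
| "ctx_comp (CChoice N Q) M = CChoice (ctx_comp N M) Q"

lemma fill_ctx_comp: "(ctx_comp N M)\<langle>P\<rangle> = N\<langle>M\<langle>P\<rangle>\<rangle>"
  by (induction N) auto

text \<open>The connect around \<open>N\<close> is there because \<open>Res_Choice\<close> acts only
  inside a connect; quantifying over all \<open>N\<close> makes the relation compatible with
  contexts.\<close>

definition refines :: "proc \<Rightarrow> proc \<Rightarrow> bool" where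
  "refines P Q \<longleftrightarrow> (\<forall>N x R. reduces (Res x R N\<langle>P\<rangle>) \<longrightarrow> reduces (Res x R N\<langle>Q\<rangle>))"

lemma refines_trans [trans]: "refines P Q \<Longrightarrow> refines Q R \<Longrightarrow> refines P R"
  by (simp add: refines_def)

lemma refines_scong:
  assumes "P \<equiv>\<^sub>s Q"
  shows "refines P Q"
  unfolding refines_def
proof (intro allI impI)
  fix N x R assume "reduces (Res x R N\<langle>P\<rangle>)"
  then show "reduces (Res x R N\<langle>Q\<rangle>)"
    by (rule reduces_cong[OF scong.cong_res[OF scong.refl cong_fill[OF scong.sym[OF assms]]]])
qed

lemma refines_fill: "refines P Q \<Longrightarrow> refines M\<langle>P\<rangle> M\<langle>Q\<rangle>"
  unfolding refines_def by (simp flip: fill_ctx_comp)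

text \<open>Contexts have their hole on the left only. This lemma reaches right-hand positions
  through the commutativity laws.\<close>

lemma refines_comm:
  assumes "refines P Q" "M\<langle>P\<rangle> \<equiv>\<^sub>s P'" "M\<langle>Q\<rangle> \<equiv>\<^sub>s Q'"
  shows "refines P' Q'"
  using refines_scong[OF scong.sym[OF assms(2)]] refines_fill[OF assms(1), of M]
    refines_scong[OF assms(3)] refines_trans by blast

lemma refines_choice: "refines P P' \<Longrightarrow> refines Q Q' \<Longrightarrow> refines (P \<boxplus> Q) (P' \<boxplus> Q')"
  using refines_fill[of P P' "CChoice Hole Q"]
    refines_comm[of Q Q' "CChoice Hole P'" "P' \<boxplus> Q" "P' \<boxplus> Q'"]
  by (auto intro: refines_trans scong.choice_comm)

lemma refines_par: "refines P P' \<Longrightarrow> refines Q Q' \<Longrightarrow> refines (P \<parallel> Q) (P' \<parallel> Q')"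
  using refines_fill[of P P' "CPar Hole Q"]
    refines_comm[of Q Q' "CPar Hole P'" "P' \<parallel> Q" "P' \<parallel> Q'"]
  by (auto intro: refines_trans scong.par_comm)

lemma refines_res: "refines P P' \<Longrightarrow> refines Q Q' \<Longrightarrow> refines (Res x P Q) (Res x P' Q')"
  using refines_fill[of P P' "CRes x Hole Q"]
    refines_comm[of Q Q' "CRes x Hole P'" "Res x P' Q" "Res x P' Q'"]
  by (auto intro: refines_trans scong.res_comm)

lemma refines_dist: "dctx C \<Longrightarrow> refines (C\<langle>P\<rangle> \<boxplus> C\<langle>Q\<rangle>) C\<langle>P \<boxplus> Q\<rangle>"
  unfolding refines_def reduces_def by (blast intro: red.Res_Choice)

text \<open>Here f may keep its argument in a right-hand position, provided that it agrees with a
  D-context up to congruence.\<close>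

lemma refines_dist':
  assumes "dctx C" "\<And>P. C\<langle>P\<rangle> \<equiv>\<^sub>s f P"
  shows "refines (f P \<boxplus> f Q) (f (P \<boxplus> Q))"
proof -
  have "refines (f P \<boxplus> f Q) (C\<langle>P\<rangle> \<boxplus> C\<langle>Q\<rangle>)"
    using assms(2) by (intro refines_scong scong.cong_choice scong.sym[OF assms(2)])
  also note refines_dist[OF assms(1)]
  also note refines_scong[OF assms(2)]
  finally show ?thesis .
qed

lemma refines_map:
  assumes "\<And>P Q. refines (f P \<boxplus> f Q) (f (P \<boxplus> Q))" "Ps \<noteq> []"
  shows "refines (choices (map f Ps)) (f (choices Ps))"
  using assms(2)
proof (induction Ps)
  case (Cons P Ps)
  show ?case
  proof (cases "Ps = []")
    case True
    then show ?thesis by (simp add: refines_def)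
  next
    case False
    have "refines (f P \<boxplus> choices (map f Ps)) (f P \<boxplus> f (choices Ps))"
      using Cons.IH[OF False] by (intro refines_choice) (simp_all add: refines_def)
    also note assms(1)
    finally show ?thesis using False by (simp add: choices_Cons)
  qed
qed auto

section \<open>Products of families and the alternatives of a process\<close>

definition products :: "(proc \<Rightarrow> proc \<Rightarrow> proc) \<Rightarrow> proc list \<Rightarrow> proc list \<Rightarrow> proc list" where
  "products f Ps Qs = concat (map (\<lambda>P. map (f P) Qs) Ps)"

lemma set_products: "set (products f Ps Qs) = {f P Q | P Q. P \<in> set Ps \<and> Q \<in> set Qs}"
  by (auto simp: products_def)

lemma products_nonempty: "Ps \<noteq> [] \<Longrightarrow> Qs \<noteq> [] \<Longrightarrow> products f Ps Qs \<noteq> []"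
  by (cases Ps; cases Qs) (auto simp: products_def)

text \<open>For each left alternative the right choice is collected first, by
  \<open>refines_map\<close>; the induction then collects the left one.\<close>

lemma refines_products:
  assumes "\<And>P Q R. refines (f P R \<boxplus> f Q R) (f (P \<boxplus> Q) R)"
    "\<And>P Q R. refines (f P Q \<boxplus> f P R) (f P (Q \<boxplus> R))" "Ps \<noteq> []" "Qs \<noteq> []"
  shows "refines (choices (products f Ps Qs)) (f (choices Ps) (choices Qs))"
  using assms(3)
proof (induction Ps)
  case (Cons P Ps)
  have P: "refines (choices (map (f P) Qs)) (f P (choices Qs))"
    using assms(2,4) by (rule refines_map)
  show ?case
  proof (cases "Ps = []")
    case True
    with P show ?thesis by (simp add: products_def)
  next
    case False
    have "choices (products f (P # Ps) Qs) \<equiv>\<^sub>s choices (map (f P) Qs) \<boxplus> choices (products f Ps Qs)"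
      using choices_append[of "map (f P) Qs" "products f Ps Qs"] assms(4) products_nonempty[OF False]
      by (simp add: products_def)
    then have "refines (choices (products f (P # Ps) Qs))
      (choices (map (f P) Qs) \<boxplus> choices (products f Ps Qs))"
      by (rule refines_scong)
    also have "refines \<dots> (f P (choices Qs) \<boxplus> f (choices Ps) (choices Qs))"
      using P Cons.IH[OF False] by (rule refines_choice)
    also note assms(1)
    finally show ?thesis using False by (simp add: choices_Cons)
  qed
qed auto

text \<open>A disjunctive normal form with respect to active choices.\<close>

primrec alternatives :: "proc \<Rightarrow> proc list" where
  "alternatives Inact = [Inact]"
| "alternatives (Fwd x y) = [Fwd x y]"
| "alternatives (Res x P Q) = products (Res x) (alternatives P) (alternatives Q)"
| "alternatives (P \<boxplus> Q) = alternatives P @ alternatives Q"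
| "alternatives (Out x y P Q) = [Out x y P Q]"
| "alternatives (Inp x y P) = [Inp x y P]"
| "alternatives (Sel x l P) = [Sel x l P]"
| "alternatives (Branch x B) = [Branch x B]"
| "alternatives (Close x) = [Close x]"
| "alternatives (Wait x P) = [Wait x P]"
| "alternatives (Expect x W P) = [Expect x W P]"
| "alternatives (Avail x P) = [Avail x P]"
| "alternatives (Unavail x) = [Unavail x]"
| "alternatives (P \<parallel> Q) = products (\<parallel>) (alternatives P) (alternatives Q)"

lemma alternatives_nonempty: "alternatives P \<noteq> []"
  by (induction P) (auto simp: products_nonempty)

lemma alternatives_choice_free: "P' \<in> set (alternatives P) \<Longrightarrow> choice_free P'"
  by (induction P arbitrary: P') (auto simp: set_products)

lemma alternatives_typed: "P \<turnstile> \<Gamma> \<Longrightarrow> P' \<in> set (alternatives P) \<Longrightarrow> P' \<turnstile> \<Gamma>"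
proof (induction arbitrary: P' rule: typed.induct)
  case (T_Branch B As x \<Gamma>)
  then show ?case by (auto intro: typed.T_Branch)
qed (auto simp: set_products intro: typed.intros)

lemma refines_alternatives: "refines (choices (alternatives P)) P"
proof (induction P)
  case (Res x P Q)
  have "refines (choices (alternatives (Res x P Q)))
    (Res x (choices (alternatives P)) (choices (alternatives Q)))"
    unfolding alternatives.simps
  proof (rule refines_products[OF _ _ alternatives_nonempty alternatives_nonempty])
    show "refines (Res x P R \<boxplus> Res x Q R) (Res x (P \<boxplus> Q) R)" for P Q R
      by (rule refines_dist'[of "CRes x Hole R"]) (simp_all add: scong.refl)
    show "refines (Res x P Q \<boxplus> Res x P R) (Res x P (Q \<boxplus> R))" for P Q R
      by (rule refines_dist'[of "CRes x Hole P"]) (simp_all add: scong.res_comm)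
  qed
  also note refines_res[OF Res.IH]
  finally show ?case .
next
  case (Par P Q)
  have "refines (choices (alternatives (P \<parallel> Q)))
    (choices (alternatives P) \<parallel> choices (alternatives Q))"
    unfolding alternatives.simps
  proof (rule refines_products[OF _ _ alternatives_nonempty alternatives_nonempty])
    show "refines (P \<parallel> R \<boxplus> Q \<parallel> R) ((P \<boxplus> Q) \<parallel> R)" for P Q R
      by (rule refines_dist'[of "CPar Hole R"]) (simp_all add: scong.refl)
    show "refines (P \<parallel> Q \<boxplus> P \<parallel> R) (P \<parallel> (Q \<boxplus> R))" for P Q R
      by (rule refines_dist'[of "CPar Hole P"]) (simp_all add: scong.par_comm)
  qed
  also note refines_par[OF Par.IH]
  finally show ?case .
next
  case (Choice P Q)
  have "refines (choices (alternatives (P \<boxplus> Q)))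
    (choices (alternatives P) \<boxplus> choices (alternatives Q))"
    by (simp add: refines_scong choices_append alternatives_nonempty)
  also note refines_choice[OF Choice.IH]
  finally show ?case .
qed (simp_all add: refines_def)

lemma reduces_refines: "refines Q' Q \<Longrightarrow> reduces (Res x P Q') \<Longrightarrow> reduces (Res x P Q)"
  unfolding refines_def by (metis fill.simps(1))


section \<open>Deadlock freedom\<close>

text \<open>A reducing alternative would make the whole choice reduce, and by refinement the connect
  too. Otherwise the alternative has a ready prefix, and as its context contains x alone, the
  subject can only be x, which also excludes forwarders.\<close>

lemma alternatives_exposed:
  assumes "P \<turnstile> fmupd x A fmempty" "\<not> reduces (Res x Q P)" "P' \<in> set (alternatives P)"
  shows "exposes x A P'"
proof -
  have T: "P' \<turnstile> fmupd x A fmempty" using assms(1,3) by (rule alternatives_typed)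
  have "fmupd x A fmempty \<noteq> fmempty"
    by (metis fmempty_lookup fmupd_lookup option.distinct(1))
  then consider "reduces P'" | \<alpha> where "ready \<alpha> P' (fmupd x A fmempty)"
    using choice_free_progress[OF alternatives_choice_free[OF assms(3)] T] by blast
  then show ?thesis
  proof cases
    case 1
    have "reduces (Res x Q (choices (alternatives P)))"
      by (rule reduces_res'[OF reduces_choices[OF assms(3) 1]])
    then have "reduces (Res x Q P)" by (rule reduces_refines[OF refines_alternatives])
    with assms(2) show ?thesis by blast
  next
    case (2 \<alpha>)
    then obtain C R where C: "P' \<equiv>\<^sub>s C\<langle>R\<rangle>" "C\<langle>R\<rangle> \<turnstile> fmupd x A fmempty" "dctx C" "prefixed \<alpha> R"
      "sub \<alpha> \<inter> bn C = {}"
      unfolding ready_def by blast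
    have "sub \<alpha> \<noteq> {}" by (cases \<alpha>) auto
    then have sub: "sub \<alpha> = {x}" using ready_sub[OF 2] by auto
    moreover have "\<exists>\<Gamma>. R \<turnstile> \<Gamma> \<and> fmlookup \<Gamma> x = Some A"
      using C sub prefixed_fn[of \<alpha> R] by (intro fill_typed[OF C(2,3)]) auto
    ultimately show ?thesis using C unfolding exposes_def by blast
  qed
qed

lemma fmadd_empty:
  assumes "\<Gamma> ++\<^sub>f \<Delta> = fmempty"
  shows "\<Gamma> = fmempty" "\<Delta> = fmempty"
proof -
  have "fmdom \<Gamma> |\<union>| fmdom \<Delta> = {||}" using arg_cong[OF assms, of fmdom] by simp
  then show "\<Gamma> = fmempty" "\<Delta> = fmempty" by (auto intro!: fmap_ext fmdom_notD)
qed

lemma reduces_closed_cut: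
  assumes "Res x P Q \<turnstile> fmempty"
  shows "reduces (Res x P Q)"
proof (rule ccontr)
  assume irr: "\<not> reduces (Res x P Q)"
  from assms obtain A \<Gamma> \<Delta> where T: "fmempty = \<Gamma> ++\<^sub>f \<Delta>" "P \<turnstile> fmupd x A \<Gamma>" "Q \<turnstile> fmupd x (dual A) \<Delta>"
    by (cases rule: typed.cases) blast
  \<comment> \<open>As the connect is closed, x is the only name in the context of either
    side.\<close>
  note T = T(2,3)[unfolded fmadd_empty[OF T(1)[symmetric]]]
  have swap: "reduces (Res x P Q)" if "reduces (Res x Q P)" for P Q
    using that by (rule reduces_cong[OF scong.res_comm])
  have "\<not> reduces (Res x Q P)" using irr swap by blast
  then have "\<forall>P' \<in> set (alternatives P). exposes x A P'"
    using alternatives_exposed[OF T(1)] by blast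
  moreover have "\<forall>Q' \<in> set (alternatives Q). exposes x (dual A) Q'"
    using alternatives_exposed[OF T(2) irr] by blast
  ultimately have "reduces (Res x (choices (alternatives P)) (choices (alternatives Q)))"
    by (intro reduces_interaction alternatives_nonempty)
  \<comment> \<open>Refinement acts on the right argument of a connect, so Q is restored first, then
    the sides are swapped to restore P.\<close>
  then have "reduces (Res x Q (choices (alternatives P)))"
    by (rule swap[OF reduces_refines[OF refines_alternatives]])
  then have "reduces (Res x P Q)" by (rule swap[OF reduces_refines[OF refines_alternatives]])
  with irr show False ..
qed

text \<open>A closed connect always reduces and a prefix is never closed. Choices and parallel
  compositions of processes congruent to inaction collapse to it by \<open>choice_idem\<close> and
  \<open>par_inact\<close>.\<close>

lemma closed_progress: "P \<turnstile> fmempty \<Longrightarrow> P \<equiv>\<^sub>s Inact \<or> reduces P"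
proof (induction P)
  case Inact
  show ?case by (simp add: scong.refl)
next
  case (Res x P Q)
  then show ?case by (simp add: reduces_closed_cut)
next
  case (Choice P Q)
  then have "P \<turnstile> fmempty" "Q \<turnstile> fmempty" by (auto elim: typed.cases)
  with Choice.IH consider "P \<equiv>\<^sub>s Inact" "Q \<equiv>\<^sub>s Inact" | "reduces P" | "reduces Q" by blast
  then show ?case
  proof cases
    case 1
    then have "P \<boxplus> Q \<equiv>\<^sub>s Inact \<boxplus> Inact" by (rule scong.cong_choice)
    then show ?thesis using scong.trans scong.choice_idem by blast
  qed (simp_all add: reduces_choice reduces_choice')
next
  case (Par P Q)
  from Par.prems obtain \<Gamma> \<Delta> where "fmempty = \<Gamma> ++\<^sub>f \<Delta>" "P \<turnstile> \<Gamma>" "Q \<turnstile> \<Delta>"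
    by (cases rule: typed.cases) blast
  then have "P \<turnstile> fmempty" "Q \<turnstile> fmempty" using fmadd_empty by metis+
  with Par.IH consider "P \<equiv>\<^sub>s Inact" "Q \<equiv>\<^sub>s Inact" | "reduces P" | "reduces Q" by blast
  then show ?case
  proof cases
    case 1
    then have "P \<parallel> Q \<equiv>\<^sub>s Inact \<parallel> Inact" by (rule scong.cong_par)
    then show ?thesis using scong.trans scong.par_inact by blast
  qed (simp_all add: reduces_par reduces_par')
\<comment> \<open>For a prefix, the domain of the context contains its subject and so is not
  empty.\<close>
qed (auto elim: typed.cases dest: arg_cong[of _ fmempty fmdom])

theorem mainTheorem2:
  fixes P :: proc
  assumes "P \<turnstile> fmempty" and "\<not> P \<equiv>\<^sub>s Inact"
  shows "\<exists>Q S. S \<noteq> {} \<and> P \<leadsto>[S] Q"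
  using closed_progress[OF assms(1)] assms(2) by (simp add: reduces_def)

end
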